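(* Let $X\subset\mathbb{R}^d$ be a compact convex set with non-empty interior and let $c(x,y)=\|x-y\|^2$. For $\mu\in\mathcal{P}(X)$ and $\dot\mu=-\mathrm{div}(\mu v)$ with $v\in L^1(X,\mu;\mathbb{R}^d)$, it holds that $$\lim_{\varepsilon\to\infty}\mathbf{g}^\varepsilon_\mu(\dot\mu,\dot\mu)=\left\|\int_X v(x)\,d\mu(x)\right\|^2 .$$
   Context: $\mathcal{P}(X)$: Radon probability measures on $X$. $-\mathrm{div}(\mu v)$ denotes the functional $\phi\mapsto\int_X v\cdot\nabla\phi\,d\mu$ on $C^1(X)$. For $\varepsilon>0$, $f^\varepsilon_{\mu,\mu}\in C(X)$ is the unique function with $\int_X\exp\left(\frac1\varepsilon(f^\varepsilon_{\mu,\mu}(x)+f^\varepsilon_{\mu,\mu}(y)-c(x,y))\right)d\mu(x)=1$ for all $y\in X$, and $k^\varepsilon_\mu(x,y)=\exp\left(\frac1\varepsilon(f^\varepsilon_{\mu,\mu}(x)+f^\varepsilon_{\mu,\mu}(y)-c(x,y))\right)$ (a smooth kernel). $K^\varepsilon_\mu[\phi](y)=\int_X\phi(x)k^\varepsilon_\mu(x,y)\,d\mu(x)$ and, for $\nu\in C^1(X)^*$, $H^\varepsilon_\mu[\nu](y)=\langle\nu,k^\varepsilon_\mu(\cdot,y)\rangle$. $K_\mu^\varepsilon$ fixes constants and $\mathrm{id}-(K^\varepsilon_\mu)^2$ is boundedly invertible on $C^1(X)/\mathbb{R}$ (quotient by constants). The metric tensor is, for $\dot\mu\in C^1(X)^*$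 with $\langle\dot\mu,1\rangle=0$, $\mathbf{g}^\varepsilon_\mu(\dot\mu,\dot\mu)=\frac\varepsilon2\langle\dot\mu,(\mathrm{id}-(K_\mu^\varepsilon)^2)^{-1}H^\varepsilon_\mu[\dot\mu]\rangle$. *)

theory Defs
  imports "HOL-Probability.Probability"
begin

text \<open>Functions on \<open>X\<close> are represented by total functions on the ambient Euclidean space, of which
  only the values on \<open>X\<close> matter. Measures on \<open>X\<close> live on the Borel sigma-algebra of the subspace
  \<open>X\<close>, so integrals against them are integrals over \<open>X\<close>.\<close>

text \<open>Every Borel probability measure on a compact subset of a Euclidean space is Radon.\<close>

definition prob_measures_on :: "'a::euclidean_space set \<Rightarrow> 'a measure set" where
  "prob_measures_on X = {\<mu>. sets \<mu> = sets (restrict_space borel X) \<and> prob_space \<mu>}"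

definition sq_cost :: "'a::euclidean_space \<Rightarrow> 'a \<Rightarrow> real" where
  "sq_cost x y = (norm (x - y))\<^sup>2"


text \<open>Derivatives are taken within \<open>X\<close>. If \<open>X\<close> is convex with non-empty interior they are unique
  at every point of \<open>X\<close>, and at boundary points the gradient of a \<open>C\<^sup>1\<close> function is the continuous
  extension of the gradient in the interior.\<close>

definition C1 :: "'a::euclidean_space set \<Rightarrow> ('a \<Rightarrow> real) set" where
  "C1 X = {\<phi>. \<exists>D. continuous_on X D \<and>
                 (\<forall>x\<in>X. (\<phi> has_derivative (\<lambda>h. D x \<bullet> h)) (at x within X))}"

definition grad :: "'a::euclidean_space set \<Rightarrow> ('a \<Rightarrow> real) \<Rightarrow> 'a \<Rightarrow> 'a" where
  "grad X \<phi> x = (THE D. (\<phi> has_derivative (\<lambda>h. D \<bullet> h)) (at x within X))"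

text \<open>The functional \<open>-div (\<mu> v)\<close> on \<open>C1 X\<close>.\<close>

definition neg_div ::
    "'a::euclidean_space set \<Rightarrow> 'a measure \<Rightarrow> ('a \<Rightarrow> 'a) \<Rightarrow> ('a \<Rightarrow> real) \<Rightarrow> real" where
  "neg_div X \<mu> v \<phi> = (\<integral>x. v x \<bullet> grad X \<phi> x \<partial>\<mu>)"


text \<open>The self-transport potential \<open>f\<close>; membership in \<open>extensional X\<close> only pins down the irrelevant
  values outside \<open>X\<close>, so that uniqueness in \<open>C(X)\<close> becomes uniqueness of a total function.\<close>

definition potential ::
    "('a::euclidean_space \<Rightarrow> 'a \<Rightarrow> real) \<Rightarrow> 'a set \<Rightarrow> real \<Rightarrow> 'a measure \<Rightarrow> 'a \<Rightarrow> real" where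
  "potential c X \<epsilon> \<mu> = (THE f. f \<in> extensional X \<and> continuous_on X f \<and>
     (\<forall>y\<in>X. (\<integral>x. exp (1 / \<epsilon> * (f x + f y - c x y)) \<partial>\<mu>) = 1))"

definition kern ::
    "('a::euclidean_space \<Rightarrow> 'a \<Rightarrow> real) \<Rightarrow> 'a set \<Rightarrow> real \<Rightarrow> 'a measure \<Rightarrow> 'a \<Rightarrow> 'a \<Rightarrow> real" where
  "kern c X \<epsilon> \<mu> x y = exp (1 / \<epsilon> * (potential c X \<epsilon> \<mu> x + potential c X \<epsilon> \<mu> y - c x y))"

definition K_op ::
    "('a::euclidean_space \<Rightarrow> 'a \<Rightarrow> real) \<Rightarrow> 'a set \<Rightarrow> real \<Rightarrow> 'a measure \<Rightarrow>
     ('a \<Rightarrow> real) \<Rightarrow> 'a \<Rightarrow> real" where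
  "K_op c X \<epsilon> \<mu> \<phi> y = (\<integral>x. \<phi> x * kern c X \<epsilon> \<mu> x y \<partial>\<mu>)"

definition H_op ::
    "('a::euclidean_space \<Rightarrow> 'a \<Rightarrow> real) \<Rightarrow> 'a set \<Rightarrow> real \<Rightarrow> 'a measure \<Rightarrow>
     (('a \<Rightarrow> real) \<Rightarrow> real) \<Rightarrow> 'a \<Rightarrow> real" where
  "H_op c X \<epsilon> \<mu> \<nu> y = \<nu> (\<lambda>x. kern c X \<epsilon> \<mu> x y)"


text \<open>The quotient of \<open>C1 X\<close> by constants, with the maps induced on it. Functions that agree on
  \<open>X\<close> lie in the same class.\<close>

definition const_rel :: "'a::euclidean_space set \<Rightarrow> (('a \<Rightarrow> real) \<times> ('a \<Rightarrow> real)) set" where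
  "const_rel X = {(\<phi>, \<psi>). \<phi> \<in> C1 X \<and> \<psi> \<in> C1 X \<and> (\<exists>a. \<forall>x\<in>X. \<phi> x = \<psi> x + a)}"

definition C1_mod_const :: "'a::euclidean_space set \<Rightarrow> ('a \<Rightarrow> real) set set" where
  "C1_mod_const X = C1 X // const_rel X"

definition quot_class :: "'a::euclidean_space set \<Rightarrow> ('a \<Rightarrow> real) \<Rightarrow> ('a \<Rightarrow> real) set" where
  "quot_class X \<phi> = const_rel X `` {\<phi>}"

definition quot_map ::
    "'a::euclidean_space set \<Rightarrow> (('a \<Rightarrow> real) \<Rightarrow> ('a \<Rightarrow> real)) \<Rightarrow>
     ('a \<Rightarrow> real) set \<Rightarrow> ('a \<Rightarrow> real) set" where
  "quot_map X T Q = (\<Union>\<phi>\<in>Q. quot_class X (T \<phi>))"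

text \<open>The pairing of a class with a functional that vanishes on constants, i.e. the common value of
  \<open>\<nu>\<close> on the representatives.\<close>

definition quot_pairing :: "(('a \<Rightarrow> real) \<Rightarrow> real) \<Rightarrow> ('a \<Rightarrow> real) set \<Rightarrow> real" where
  "quot_pairing \<nu> Q = the_elem (\<nu> ` Q)"

definition id_minus_K2 ::
    "('a::euclidean_space \<Rightarrow> 'a \<Rightarrow> real) \<Rightarrow> 'a set \<Rightarrow> real \<Rightarrow> 'a measure \<Rightarrow>
     ('a \<Rightarrow> real) set \<Rightarrow> ('a \<Rightarrow> real) set" where
  "id_minus_K2 c X \<epsilon> \<mu> =
     quot_map X (\<lambda>\<phi> y. \<phi> y - K_op c X \<epsilon> \<mu> (K_op c X \<epsilon> \<mu> \<phi>) y)"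

definition metric_tensor ::
    "('a::euclidean_space \<Rightarrow> 'a \<Rightarrow> real) \<Rightarrow> 'a set \<Rightarrow> real \<Rightarrow> 'a measure \<Rightarrow>
     (('a \<Rightarrow> real) \<Rightarrow> real) \<Rightarrow> (('a \<Rightarrow> real) \<Rightarrow> real) \<Rightarrow> real" where
  "metric_tensor c X \<epsilon> \<mu> \<nu> \<nu>' =
     \<epsilon> / 2 * quot_pairing \<nu>
       (the_inv_into (C1_mod_const X) (id_minus_K2 c X \<epsilon> \<mu>) (quot_class X (H_op c X \<epsilon> \<mu> \<nu>')))"

end

theory Submission
  imports Defs
begin

text \<open>Put \<open>t = 2 / \<epsilon>\<close>. As \<open>\<epsilon> \<rightarrow> \<infinity>\<close> the kernel \<open>k\<close> is uniformly close to \<open>1\<close>, and it has the form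
  \<open>k(x,y) = a(x) a(y) exp (t x \<bullet> y)\<close>, where \<open>a\<close> is on \<open>X\<close> the reciprocal of a Laplace transform; so
  \<open>\<nabla>\<^sub>x k(x,y) = t k(x,y) (y - b(x))\<close> with the barycentre \<open>b(x) = \<integral> z k(z,x) d\<mu>(z)\<close>. Hence
  \<open>H[\<mu>'] = t \<Psi>\<close> with \<open>\<Psi>(y) = \<integral> v(x) \<bullet> (y - b(x)) k(x,y) d\<mu>(x)\<close>, and \<open>\<nabla>\<Psi>\<close> tends uniformly to
  \<open>V = \<integral> v d\<mu>\<close>. On continuous functions modulo constants \<open>K\<^sup>2\<close> is a contraction, and it sends bounded
  sets to functions with gradient \<open>O(t)\<close>; so \<open>\<phi> - K\<^sup>2 \<phi> = \<Psi> + const\<close> has a solution whose gradient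
  also tends uniformly to \<open>V\<close>, and the metric tensor \<open>\<epsilon> / 2 * t * \<integral> v \<bullet> \<nabla>\<phi> d\<mu>\<close> tends to \<open>|V|\<^sup>2\<close>.\<close>

subsection \<open>Fixed points and Laplace transforms\<close>

text \<open>Banach's theorem is applied in the complete space of bounded continuous functions on all
  of \<open>'a\<close>. A function on \<open>X\<close> is carried there by composition with the
  nearest-point projection, which is continuous because \<open>X\<close> is closed and
  convex.\<close>

lemma contraction_on_compact_convex_fixpoint:
  fixes X :: "'a::euclidean_space set" and T :: "('a \<Rightarrow> real) \<Rightarrow> 'a \<Rightarrow> real"
  assumes X: "compact X" "convex X" "X \<noteq> {}" and q: "0 \<le> q" "q < 1"
    and cont: "\<And>g. continuous_on X g \<Longrightarrow> continuous_on X (T g)"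
    and contr: "\<And>g h M x. continuous_on X g \<Longrightarrow> continuous_on X h \<Longrightarrow>
      (\<And>z. z \<in> X \<Longrightarrow> \<bar>g z - h z\<bar> \<le> M) \<Longrightarrow> x \<in> X \<Longrightarrow> \<bar>T g x - T h x\<bar> \<le> q * M"
  obtains g where "continuous_on X g" "\<And>x. x \<in> X \<Longrightarrow> T g x = g x"
proof -
  let ?p = "closest_point X"
  have p_in: "?p x \<in> X" for x
    using X closest_point_in_set compact_imp_closed by blast
  have p_cont: "continuous_on UNIV ?p"
    using X compact_imp_closed continuous_on_closest_point by blast
  have bc: "(\<lambda>x. g (?p x)) \<in> bcontfun" if "continuous_on X g" for g :: "'a \<Rightarrow> real"
  proof -
    have "continuous_on UNIV (\<lambda>x. g (?p x))"
      using continuous_on_compose2[OF that p_cont] p_in by auto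
    moreover have "bounded (range (\<lambda>x. g (?p x)))"
      using compact_imp_bounded[OF compact_continuous_image[OF that X(1)]]
      by (rule bounded_subset) (use p_in in auto)
    ultimately show ?thesis by (simp add: bcontfun_def)
  qed
  define F where "F u = Bcontfun (\<lambda>x. T (apply_bcontfun u) (?p x))" for u
  have cu: "continuous_on X (apply_bcontfun u)" for u :: "'a \<Rightarrow>\<^sub>C real"
    by (rule continuous_on_subset[OF continuous_on_apply_bcontfun]) auto
  have F: "apply_bcontfun (F u) x = T (apply_bcontfun u) (?p x)" for u x
    unfolding F_def using Bcontfun_inverse[OF bc[OF cont[OF cu]]] by simp
  have "dist (F u) (F w) \<le> q * dist u w" for u w
    by (rule dist_bound, simp only: F dist_real_def, rule contr)
      (use cu p_in dist_bounded[of u _ w] in \<open>auto simp: dist_real_def\<close>)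
  then obtain u where u: "F u = u"
    using banach_fix_type[OF q, of F] by blast
  show ?thesis
    by (rule that[of "apply_bcontfun u"]) (use cu F[of u] u closest_point_self in \<open>metis\<close>)+
qed

lemma abs_exp_minus_linear_le:
  fixes s :: real
  assumes "\<bar>s\<bar> \<le> 1"
  shows "\<bar>exp s - 1 - s\<bar> \<le> s\<^sup>2"
proof -
  have "exp s \<le> 1 + s + s\<^sup>2"
  proof (cases "0 \<le> s")
    case True
    then show ?thesis using exp_bound assms by auto
  next
    case False
    define u where "u = - s"
    have u: "0 \<le> u" using False u_def by simp
    \<comment> \<open>The second factor is the quadratic Taylor polynomial of \<open>exp u\<close>.
      Once it is replaced by the larger \<open>exp u\<close>, dividing by \<open>exp u\<close> gives
      the upper bound for \<open>s = - u\<close>.\<close>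
    have "1 \<le> (1 - u + u\<^sup>2) * (1 + u + u\<^sup>2 / 2)"
    proof -
      have "(1 - u + u\<^sup>2) * (1 + u + u\<^sup>2 / 2) = 1 + u^2 / 2 + u^3 / 2 + u^4 / 2"
        by (simp add: field_simps power2_eq_square power3_eq_cube power4_eq_xxxx)
      then show ?thesis using u by simp
    qed
    also have "\<dots> \<le> (1 - u + u\<^sup>2) * exp u"
    proof (rule mult_left_mono)
      show "1 + u + u\<^sup>2 / 2 \<le> exp u" using exp_lower_Taylor_quadratic u by blast
      have "0 \<le> (u - 1/2)\<^sup>2 + 3/4" by simp
      then show "0 \<le> 1 - u + u\<^sup>2" by (simp add: power2_eq_square field_simps)
    qed
    finally have "exp (- u) \<le> 1 - u + u\<^sup>2"
      by (simp add: exp_minus field_simps)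
    then show ?thesis by (simp add: u_def)
  qed
  then show ?thesis using exp_ge_add_one_self[of s] zero_le_power2[of s] by linarith
qed

section \<open>Integration over a compact convex set\<close>

locale prob_on_compact = prob_space \<mu> for \<mu> :: "'a::euclidean_space measure" +
  fixes X :: "'a set" and B :: real
  assumes sets_mu: "sets \<mu> = sets (restrict_space borel X)"
    and compact_X: "compact X" and convex_X: "convex X"
    and norm_le_B: "\<And>x. x \<in> X \<Longrightarrow> norm x \<le> B"
begin

lemma space_mu: "space \<mu> = X"
  using sets_eq_imp_space_eq[OF sets_mu] by (simp add: space_restrict_space)

lemma X_nonempty: "X \<noteq> {}"
  using not_empty space_mu by simp

lemma B_nonneg: "0 \<le> B"
  using X_nonempty norm_le_B norm_ge_zero order_trans by blast

lemma continuous_on_imp_measurable: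
  "continuous_on X f \<Longrightarrow> f \<in> borel_measurable \<mu>" for f :: "'a \<Rightarrow> 'b::topological_space"
  using borel_measurable_continuous_on_restrict measurable_cong_sets[OF sets_mu refl] by blast

lemma continuous_on_bound:
  fixes f :: "'a \<Rightarrow> 'b::real_normed_vector"
  assumes "continuous_on X f"
  obtains M where "0 < M" "\<And>x. x \<in> X \<Longrightarrow> norm (f x) \<le> M"
proof -
  have "bounded (f ` X)"
    using assms compact_X compact_continuous_image compact_imp_bounded by blast
  then show ?thesis using that unfolding bounded_pos by auto
qed

lemma integrable_bounded_scaleR:
  fixes w :: "'a \<Rightarrow> 'b::{banach, second_countable_topology}"
  assumes "integrable \<mu> w" "f \<in> borel_measurable \<mu>" "\<And>x. x \<in> X \<Longrightarrow> \<bar>f x\<bar> \<le> M"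
  shows "integrable \<mu> (\<lambda>x. f x *\<^sub>R w x)"
proof (rule Bochner_Integration.integrable_bound[where f="\<lambda>x. M *\<^sub>R w x"])
  show "AE x in \<mu>. norm (f x *\<^sub>R w x) \<le> norm (M *\<^sub>R w x)"
  proof (rule AE_I2)
    fix x assume "x \<in> space \<mu>"
    then have "\<bar>f x\<bar> \<le> M" using assms(3) space_mu by simp
    then show "norm (f x *\<^sub>R w x) \<le> norm (M *\<^sub>R w x)"
      by (auto intro!: mult_right_mono)
  qed
qed (use assms in auto)

lemma integrable_continuous_scaleR:
  fixes w :: "'a \<Rightarrow> 'b::{banach, second_countable_topology}"
  assumes "integrable \<mu> w" "continuous_on X f"
  shows "integrable \<mu> (\<lambda>x. f x *\<^sub>R w x)"
proof -
  obtain M where "\<And>x. x \<in> X \<Longrightarrow> norm (f x) \<le> M"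
    using continuous_on_bound[OF assms(2)] by blast
  then show ?thesis
    using integrable_bounded_scaleR[OF assms(1) continuous_on_imp_measurable[OF assms(2)]] by auto
qed

lemmas integrable_continuous_mult = integrable_continuous_scaleR[where 'b=real, simplified]

lemma integrable_scaleR_continuous:
  fixes f :: "'a \<Rightarrow> 'b::{banach, second_countable_topology}"
  assumes "integrable \<mu> w" "continuous_on X f"
  shows "integrable \<mu> (\<lambda>x. w x *\<^sub>R f x)"
proof -
  obtain M where M: "\<And>x. x \<in> X \<Longrightarrow> norm (f x) \<le> M"
    using continuous_on_bound[OF assms(2)] by blast
  show ?thesis
  proof (rule Bochner_Integration.integrable_bound[where f="\<lambda>x. M *\<^sub>R w x"])
    show "AE x in \<mu>. norm (w x *\<^sub>R f x) \<le> norm (M *\<^sub>R w x)"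
    proof (rule AE_I2)
      fix x assume "x \<in> space \<mu>"
      then have "norm (f x) \<le> \<bar>M\<bar>" using M space_mu by force
      then show "norm (w x *\<^sub>R f x) \<le> norm (M *\<^sub>R w x)"
        using mult_left_mono[of "norm (f x)" "\<bar>M\<bar>" "\<bar>w x\<bar>"] by (simp add: abs_mult mult.commute)
    qed
  next
    show "(\<lambda>x. w x *\<^sub>R f x) \<in> borel_measurable \<mu>"
      using assms continuous_on_imp_measurable[OF assms(2)] by measurable
  qed (use assms in auto)
qed

lemma integrable_continuous:
  fixes f :: "'a \<Rightarrow> 'b::{banach, second_countable_topology}"
  shows "continuous_on X f \<Longrightarrow> integrable \<mu> f"
  using integrable_scaleR_continuous[of "\<lambda>_. 1" f] by simp

lemma norm_integral_diff_le:
  fixes f g :: "'a \<Rightarrow> 'b::{banach, second_countable_topology}"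
  assumes "integrable \<mu> f" "integrable \<mu> g" "integrable \<mu> h"
    and "\<And>x. x \<in> X \<Longrightarrow> norm (f x - g x) \<le> h x"
  shows "norm ((\<integral>x. f x \<partial>\<mu>) - (\<integral>x. g x \<partial>\<mu>)) \<le> (\<integral>x. h x \<partial>\<mu>)"
proof -
  have "norm (\<integral>x. f x - g x \<partial>\<mu>) \<le> (\<integral>x. h x \<partial>\<mu>)"
    by (rule Bochner_Integration.integral_norm_bound_integral) (use assms space_mu in auto)
  then show ?thesis using assms by simp
qed

section \<open>Derivatives of Laplace transforms\<close>

text \<open>With \<open>s = t * (x \<bullet> h)\<close> the remainder has the integrand
  \<open>w x * exp (t * (x \<bullet> y)) * (exp s - 1 - s)\<close>. It is quadratic in
  \<open>h\<close> uniformly over the bounded set \<open>X\<close>, so it is controlled by the L1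
  norm of \<open>w\<close>.\<close>

lemma laplace_has_derivative:
  fixes w :: "'a \<Rightarrow> real"
  assumes w: "integrable \<mu> w"
  shows "((\<lambda>y. \<integral>x. w x * exp (t * (x \<bullet> y)) \<partial>\<mu>) has_derivative
    (\<lambda>h. (t *\<^sub>R (\<integral>x. (w x * exp (t * (x \<bullet> y))) *\<^sub>R x \<partial>\<mu>)) \<bullet> h)) (at y within S)"
proof -
  let ?C = "exp (\<bar>t\<bar> * B * norm y) * (t * B)\<^sup>2 * (\<integral>x. \<bar>w x\<bar> \<partial>\<mu>)"
  have int: "integrable \<mu> (\<lambda>x. w x * exp (t * (x \<bullet> z)))" for z
    using integrable_continuous_mult[OF w, of "\<lambda>x. exp (t * (x \<bullet> z))"]
    by (simp add: mult.commute continuous_intros)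
  have int2: "integrable \<mu> (\<lambda>x. (w x * exp (t * (x \<bullet> z))) *\<^sub>R x)" for z
    by (rule integrable_scaleR_continuous[OF int continuous_on_id])
  show ?thesis
  \<comment> \<open>Within this radius \<open>\<bar>s\<bar> \<le> 1\<close>, as the quadratic
    estimate for \<open>exp\<close> requires. The added 1 keeps the denominator positive when
    \<open>t * B = 0\<close>.\<close>
  proof (rule has_derivativeI_sandwich[where e="1 / (1 + \<bar>t\<bar> * B)" and H="\<lambda>z. ?C * norm (z - y)"])
    show "0 < 1 / (1 + \<bar>t\<bar> * B)" using B_nonneg by (simp add: add_pos_nonneg)
    show "bounded_linear (\<lambda>h. (t *\<^sub>R (\<integral>x. (w x * exp (t * (x \<bullet> y))) *\<^sub>R x \<partial>\<mu>)) \<bullet> h)"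
      by (rule bounded_linear_inner_right)
    have "((\<lambda>z. ?C * norm (z - y)) \<longlongrightarrow> ?C * norm (y - y)) (at y within S)"
      by (intro tendsto_intros)
    then show "((\<lambda>z. ?C * norm (z - y)) \<longlongrightarrow> 0) (at y within S)" by simp
    fix z assume z: "z \<noteq> y" "dist z y < 1 / (1 + \<bar>t\<bar> * B)"
    define h where "h = z - y"
    have h: "\<bar>t\<bar> * B * norm h \<le> 1"
    proof -
      have "norm h * (1 + \<bar>t\<bar> * B) \<le> 1"
        using z B_nonneg by (simp add: h_def dist_norm field_simps add_pos_nonneg)
      then show ?thesis by (simp add: algebra_simps) (use norm_ge_zero[of h] in linarith)
    qed
    have lin: "(t *\<^sub>R (\<integral>x. (w x * exp (t * (x \<bullet> y))) *\<^sub>R x \<partial>\<mu>)) \<bullet> h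
        = (\<integral>x. w x * exp (t * (x \<bullet> y)) * (t * (x \<bullet> h)) \<partial>\<mu>)"
      using int2[of y] by (simp flip: integral_inner_left integral_mult_right_zero
          add: algebra_simps)
    have int3: "integrable \<mu> (\<lambda>x. w x * exp (t * (x \<bullet> y)) * (t * (x \<bullet> h)))"
      using integrable_continuous_mult[OF int, of "\<lambda>x. t * (x \<bullet> h)" y]
      by (simp add: mult.commute continuous_intros)
    have "norm ((\<integral>x. w x * exp (t * (x \<bullet> z)) \<partial>\<mu>) - (\<integral>x. w x * exp (t * (x \<bullet> y)) + w x * exp (t * (x \<bullet> y)) * (t * (x \<bullet> h)) \<partial>\<mu>))
      \<le> (\<integral>x. (exp (\<bar>t\<bar> * B * norm y) * (t * B)\<^sup>2 * (norm h)\<^sup>2) * \<bar>w x\<bar> \<partial>\<mu>)"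
    proof (rule norm_integral_diff_le)
      fix x assume x: "x \<in> X"
      let ?s = "t * (x \<bullet> h)"
      have ab: "\<bar>t * (x \<bullet> u)\<bar> \<le> \<bar>t\<bar> * B * norm u" for u
      proof -
        have "\<bar>x \<bullet> u\<bar> \<le> B * norm u"
          using Cauchy_Schwarz_ineq2[of x u] norm_le_B[OF x] mult_right_mono[of "norm x" B "norm u"]
          by simp
        then have "\<bar>t\<bar> * \<bar>x \<bullet> u\<bar> \<le> \<bar>t\<bar> * (B * norm u)" by (rule mult_left_mono) simp
        then show ?thesis by (simp add: abs_mult mult.assoc)
      qed
      have s1: "\<bar>exp ?s - 1 - ?s\<bar> \<le> ?s\<^sup>2"
        by (rule abs_exp_minus_linear_le) (use ab[of h] h in linarith)
      also have "?s\<^sup>2 \<le> (\<bar>t\<bar> * B * norm h)\<^sup>2"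
        using ab[of h] by (metis abs_ge_zero power2_abs power_mono)
      also have "\<dots> = (t * B)\<^sup>2 * (norm h)\<^sup>2" by (simp add: power_mult_distrib)
      finally have s2: "\<bar>exp ?s - 1 - ?s\<bar> \<le> (t * B)\<^sup>2 * (norm h)\<^sup>2" .
      have e: "exp (t * (x \<bullet> y)) \<le> exp (\<bar>t\<bar> * B * norm y)" using ab[of y] by simp
      have "w x * exp (t * (x \<bullet> z)) - (w x * exp (t * (x \<bullet> y)) + w x * exp (t * (x \<bullet> y)) * ?s)
        = w x * (exp (t * (x \<bullet> y)) * (exp ?s - 1 - ?s))"
        by (simp add: h_def algebra_simps exp_diff inner_diff_right)
      moreover have "exp (t * (x \<bullet> y)) * \<bar>exp ?s - 1 - ?s\<bar>
          \<le> exp (\<bar>t\<bar> * B * norm y) * ((t * B)\<^sup>2 * (norm h)\<^sup>2)"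
        by (rule mult_mono[OF e s2]) auto
      then have "\<bar>w x\<bar> * (exp (t * (x \<bullet> y)) * \<bar>exp ?s - 1 - ?s\<bar>)
          \<le> \<bar>w x\<bar> * (exp (\<bar>t\<bar> * B * norm y) * ((t * B)\<^sup>2 * (norm h)\<^sup>2))"
        by (rule mult_left_mono) simp
      ultimately show "norm (w x * exp (t * (x \<bullet> z)) - (w x * exp (t * (x \<bullet> y)) + w x * exp (t * (x \<bullet> y)) * ?s))
        \<le> (exp (\<bar>t\<bar> * B * norm y) * (t * B)\<^sup>2 * (norm h)\<^sup>2) * \<bar>w x\<bar>"
        by (simp add: abs_mult mult.commute mult.left_commute)
    qed (use int int3 w in auto)
    then have "norm ((\<integral>x. w x * exp (t * (x \<bullet> z)) \<partial>\<mu>) - (\<integral>x. w x * exp (t * (x \<bullet> y)) \<partial>\<mu>)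
        - (t *\<^sub>R (\<integral>x. (w x * exp (t * (x \<bullet> y))) *\<^sub>R x \<partial>\<mu>)) \<bullet> h) \<le> ?C * norm h * norm h"
      unfolding lin using int int3 by (simp add: algebra_simps power2_eq_square)
    moreover have "norm h > 0" using z h_def by simp
    ultimately show "norm ((\<integral>x. w x * exp (t * (x \<bullet> z)) \<partial>\<mu>) - (\<integral>x. w x * exp (t * (x \<bullet> y)) \<partial>\<mu>)
        - (t *\<^sub>R (\<integral>x. (w x * exp (t * (x \<bullet> y))) *\<^sub>R x \<partial>\<mu>)) \<bullet> (z - y)) / norm (z - y) \<le> ?C * norm (z - y)"
      unfolding h_def[symmetric] by (simp add: pos_divide_le_eq)
  qed
qed

lemma laplace_continuous_on:
  fixes w :: "'a \<Rightarrow> real"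
  assumes "integrable \<mu> w"
  shows "continuous_on S (\<lambda>y. \<integral>x. w x * exp (t * (x \<bullet> y)) \<partial>\<mu>)"
  by (rule has_derivative_continuous_on[OF laplace_has_derivative[OF assms]])

text \<open>Each component is again a Laplace transform, with the integrable weight
  \<open>w x * (x \<bullet> i)\<close>, so it is differentiable and therefore continuous.\<close>

lemma laplace_gradient_continuous_on:
  fixes w :: "'a \<Rightarrow> real"
  assumes w: "integrable \<mu> w"
  shows "continuous_on S (\<lambda>y. \<integral>x. (w x * exp (t * (x \<bullet> y))) *\<^sub>R x \<partial>\<mu>)"
proof (rule continuous_on_componentwise[THEN iffD2], rule ballI)
  fix i :: 'a assume "i \<in> Basis"
  have "integrable \<mu> (\<lambda>x. w x * exp (t * (x \<bullet> y)))" for y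
    using integrable_continuous_mult[OF w, of "\<lambda>x. exp (t * (x \<bullet> y))"]
    by (simp add: mult.commute continuous_intros)
  then have "(\<integral>x. (w x * exp (t * (x \<bullet> y))) *\<^sub>R x \<partial>\<mu>) \<bullet> i
      = (\<integral>x. (w x * (x \<bullet> i)) * exp (t * (x \<bullet> y)) \<partial>\<mu>)" for y
    using integrable_scaleR_continuous[OF _ continuous_on_id]
    by (simp flip: integral_inner_left add: algebra_simps)
  moreover have "integrable \<mu> (\<lambda>x. w x * (x \<bullet> i))"
    using integrable_continuous_mult[OF w, of "\<lambda>x. x \<bullet> i"]
    by (simp add: mult.commute continuous_intros)
  ultimately show "continuous_on S (\<lambda>y. (\<integral>x. (w x * exp (t * (x \<bullet> y))) *\<^sub>R x \<partial>\<mu>) \<bullet> i)"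
    using laplace_continuous_on by simp
qed

end

section \<open>Uniqueness of the gradient within a convex body\<close>

text \<open>This evaluates the definite description in \<open>grad\<close>. If \<open>n\<close> is
  the difference of two candidates, differentiating along segments in \<open>X\<close> that start at
  \<open>x\<close> gives \<open>n \<bullet> (u - x) = 0\<close> for all \<open>u\<close> in
  \<open>X\<close>. Two such \<open>u\<close> in an interior ball that differ by a positive multiple
  of \<open>n\<close> force \<open>n = 0\<close>.\<close>

lemma grad_eqI:
  assumes "(f has_derivative (\<lambda>h. D \<bullet> h)) (at x within X)"
    and "convex X" "interior X \<noteq> {}" "x \<in> X"
  shows "grad X f x = D"
  unfolding grad_def
proof (rule the_equality)
  show "(f has_derivative (\<lambda>h. D \<bullet> h)) (at x within X)" by fact
  fix D' assume D': "(f has_derivative (\<lambda>h. D' \<bullet> h)) (at x within X)"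
  show "D' = D"
  proof (rule ccontr)
    assume "D' \<noteq> D"
    obtain z where z: "z \<in> interior X" using assms by blast
    then obtain e where e: "0 < e" "ball z e \<subseteq> X"
      by (meson mem_interior)
    define n where "n = D' - D"
    have "((\<lambda>x. f x - f x) has_derivative (\<lambda>h. n \<bullet> h)) (at x within X)"
      using has_derivative_diff[OF D' assms(1)] by (simp add: n_def inner_diff_left)
    then have 0: "((\<lambda>x. 0) has_derivative (\<lambda>h. n \<bullet> h)) (at x within X)" by simp
    have dir: "n \<bullet> (u - x) = 0" if u: "u \<in> X" for u
    proof -
      let ?l = "\<lambda>s. x + s *\<^sub>R (u - x)"
      have l: "(?l has_derivative (\<lambda>s. s *\<^sub>R (u - x))) (at 0 within {0..1})"
        by (auto intro!: derivative_eq_intros)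
      have "?l ` {0..1} \<subseteq> X"
        using convexD_alt[OF assms(2,4) u] by (auto simp: algebra_simps)
      then have "((\<lambda>x. 0) has_derivative (\<lambda>h. n \<bullet> h)) (at (?l 0) within ?l ` {0..1})"
        using has_derivative_subset[OF 0] by simp
      from has_derivative_in_compose[OF l this]
      have "((\<lambda>s. 0) has_vector_derivative (n \<bullet> (u - x))) (at (0::real) within cbox 0 1)"
        by (simp add: has_vector_derivative_def)
      moreover have "((\<lambda>s. 0) has_vector_derivative 0) (at (0::real) within cbox 0 1)"
        by (simp add: has_vector_derivative_def)
      ultimately show ?thesis
        using vector_derivative_unique_within_closed_interval[of 0 1 0 "\<lambda>_. 0" "n \<bullet> (u - x)" 0]
        by simp
    qed
    have "n \<bullet> n = 0"
    proof -
      define s where "s = e / (2 * norm n)"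
      have "norm n > 0" using \<open>D' \<noteq> D\<close> n_def by simp
      then have "s > 0" "norm (s *\<^sub>R n) < e" using e(1) by (auto simp: s_def)
      then have "z + s *\<^sub>R n \<in> ball z e" by (simp add: dist_norm)
      then have "n \<bullet> (z + s *\<^sub>R n - x) = 0" using dir e by blast
      moreover have "n \<bullet> (z - x) = 0" using dir[of z] z interior_subset by blast
      ultimately have "s * (n \<bullet> n) = 0" by (simp add: algebra_simps inner_diff_right inner_add_right)
      then show ?thesis using \<open>s > 0\<close> by simp
    qed
    then show False using \<open>D' \<noteq> D\<close> n_def by simp
  qed
qed

subsection \<open>Kernels close to one\<close>

text \<open>Abstract form of the self-transport kernel for the squared distance: expanding the cost
  leaves only the cross term in the exponential, and the factors depending on one point go into
  \<open>a\<close>. The bound on \<open>\<delta>\<close> makes the square of \<open>K\<close> a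
  contraction modulo constants.\<close>

locale near_one_kernel = prob_on_compact \<mu> X B
  for \<mu> :: "'a::euclidean_space measure" and X :: "'a set" and B :: real +
  fixes t \<delta> :: real and a :: "'a \<Rightarrow> real"
  assumes t_pos: "0 < t"
    and a_cont: "continuous_on X a"
    and a_pos: "\<And>x. x \<in> X \<Longrightarrow> 0 < a x"
    and kernel_normalised: "\<And>y. y \<in> X \<Longrightarrow> (\<integral>x. a x * a y * exp (t * (x \<bullet> y)) \<partial>\<mu>) = 1"
    and kernel_near_one: "\<And>x y. x \<in> X \<Longrightarrow> y \<in> X \<Longrightarrow> \<bar>a x * a y * exp (t * (x \<bullet> y)) - 1\<bar> \<le> \<delta>"
    and \<delta>_le: "\<delta> \<le> 1 / 4"
begin

definition k :: "'a \<Rightarrow> 'a \<Rightarrow> real" where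
  "k x y = a x * a y * exp (t * (x \<bullet> y))"

definition K :: "('a \<Rightarrow> real) \<Rightarrow> 'a \<Rightarrow> real" where
  "K w y = (\<integral>x. w x * k x y \<partial>\<mu>)"

text \<open>For \<open>y\<close> in \<open>X\<close>, \<open>Kvec (\<lambda>_. 1) y\<close> is the
  barycentre of the probability measure with density \<open>\<lambda>x. k x y\<close>.\<close>

definition Kvec :: "('a \<Rightarrow> real) \<Rightarrow> 'a \<Rightarrow> 'a" where
  "Kvec w y = (\<integral>x. (w x * k x y) *\<^sub>R x \<partial>\<mu>)"

text \<open>The gradient of \<open>K w\<close>.\<close>

definition G :: "('a \<Rightarrow> real) \<Rightarrow> 'a \<Rightarrow> 'a" where
  "G w y = t *\<^sub>R (Kvec w y - K w y *\<^sub>R Kvec (\<lambda>_. 1) y)"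

section \<open>Bounds for the integral operators\<close>

lemma k_cont: "y \<in> X \<Longrightarrow> continuous_on X (\<lambda>x. k x y)"
  unfolding k_def by (intro continuous_intros a_cont)

lemma integral_k: "y \<in> X \<Longrightarrow> (\<integral>x. k x y \<partial>\<mu>) = 1"
  unfolding k_def by (rule kernel_normalised)

lemma \<delta>_nonneg: "0 \<le> \<delta>"
  using X_nonempty kernel_near_one by (meson abs_ge_zero all_not_in_conv order_trans)

lemma abs_k_le: "x \<in> X \<Longrightarrow> y \<in> X \<Longrightarrow> \<bar>k x y\<bar> \<le> 5 / 4"
  using kernel_near_one[of x y] \<delta>_le by (simp add: k_def)

lemma integrable_mult_k:
  assumes "integrable \<mu> w" "y \<in> X"
  shows "integrable \<mu> (\<lambda>x. w x * k x y)"
  using integrable_continuous_mult[OF assms(1) k_cont[OF assms(2)]] by (simp add: mult.commute)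

lemma integrable_mult_k_scaleR:
  assumes "integrable \<mu> w" "y \<in> X"
  shows "integrable \<mu> (\<lambda>x. (w x * k x y) *\<^sub>R x)"
  by (rule integrable_scaleR_continuous[OF integrable_mult_k[OF assms] continuous_on_id])

lemma K_diff:
  assumes "integrable \<mu> w" "integrable \<mu> w'" "y \<in> X"
  shows "K (\<lambda>x. w x - w' x) y = K w y - K w' y"
  unfolding K_def using integrable_mult_k[OF assms(1,3)] integrable_mult_k[OF assms(2,3)]
  by (simp add: left_diff_distrib)

lemma K_cong: "(\<And>x. x \<in> X \<Longrightarrow> w x = w' x) \<Longrightarrow> K w y = K w' y"
  unfolding K_def by (rule Bochner_Integration.integral_cong) (auto simp: space_mu)

text \<open>A kernel close to 1 makes \<open>K w\<close> almost constant. The error is measured in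
  the L1 norm of \<open>w\<close>, so that the bound applies to the components of a field
  \<open>v\<close> that is only integrable.\<close>

lemma abs_K_minus_integral_le:
  assumes w: "integrable \<mu> w" and y: "y \<in> X"
  shows "\<bar>K w y - (\<integral>x. w x \<partial>\<mu>)\<bar> \<le> \<delta> * (\<integral>x. \<bar>w x\<bar> \<partial>\<mu>)"
proof -
  have "norm ((\<integral>x. w x * k x y \<partial>\<mu>) - (\<integral>x. w x \<partial>\<mu>)) \<le> (\<integral>x. \<delta> * \<bar>w x\<bar> \<partial>\<mu>)"
  proof (rule norm_integral_diff_le)
    fix x assume "x \<in> X"
    then have "\<bar>w x\<bar> * \<bar>k x y - 1\<bar> \<le> \<bar>w x\<bar> * \<delta>"
      using kernel_near_one[OF _ y] by (intro mult_left_mono) (auto simp: k_def)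
    then show "norm (w x * k x y - w x) \<le> \<delta> * \<bar>w x\<bar>"
      by (simp add: algebra_simps flip: abs_mult)
  qed (use w integrable_mult_k[OF w y] in auto)
  then show ?thesis by (simp add: K_def)
qed

lemma abs_K_le:
  assumes w: "integrable \<mu> w" and y: "y \<in> X"
  shows "\<bar>K w y\<bar> \<le> 5 / 4 * (\<integral>x. \<bar>w x\<bar> \<partial>\<mu>)"
proof -
  have "\<bar>\<integral>x. w x \<partial>\<mu>\<bar> \<le> (\<integral>x. \<bar>w x\<bar> \<partial>\<mu>)" by (rule integral_abs_bound)
  moreover have "\<delta> * (\<integral>x. \<bar>w x\<bar> \<partial>\<mu>) \<le> 1 / 4 * (\<integral>x. \<bar>w x\<bar> \<partial>\<mu>)"
    by (rule mult_right_mono[OF \<delta>_le]) simp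
  ultimately show ?thesis using abs_K_minus_integral_le[OF w y] by linarith
qed

lemma norm_Kvec_le:
  assumes w: "integrable \<mu> w" and y: "y \<in> X"
  shows "norm (Kvec w y) \<le> 5 / 4 * B * (\<integral>x. \<bar>w x\<bar> \<partial>\<mu>)"
proof -
  have "norm ((\<integral>x. (w x * k x y) *\<^sub>R x \<partial>\<mu>) - (\<integral>x. 0 \<partial>\<mu>)) \<le> (\<integral>x. (5 / 4 * B) * \<bar>w x\<bar> \<partial>\<mu>)"
  proof (rule norm_integral_diff_le)
    fix x assume x: "x \<in> X"
    have "\<bar>k x y\<bar> * norm x \<le> 5 / 4 * B"
      using abs_k_le[OF x y] norm_le_B[OF x] by (intro mult_mono) auto
    then have "\<bar>w x\<bar> * (\<bar>k x y\<bar> * norm x) \<le> \<bar>w x\<bar> * (5 / 4 * B)"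
      by (rule mult_left_mono) simp
    then show "norm ((w x * k x y) *\<^sub>R x - 0) \<le> (5 / 4 * B) * \<bar>w x\<bar>"
      by (simp add: abs_mult mult.commute mult.left_commute)
  qed (use w integrable_mult_k_scaleR[OF w y] in auto)
  then show ?thesis by (simp add: Kvec_def)
qed

lemma norm_Kvec_one_le: "y \<in> X \<Longrightarrow> norm (Kvec (\<lambda>_. 1) y) \<le> 5 / 4 * B"
  using norm_Kvec_le[of "\<lambda>_. 1" y] by (simp add: prob_space)

text \<open>The factor \<open>t\<close> is the point: gradients of \<open>K w\<close> tend to 0 with
  \<open>t\<close>, uniformly for \<open>w\<close> bounded in L1.\<close>

lemma norm_G_le:
  assumes w: "integrable \<mu> w" and y: "y \<in> X"
  shows "norm (G w y) \<le> 3 * t * B * (\<integral>x. \<bar>w x\<bar> \<partial>\<mu>)"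
proof -
  let ?N = "\<integral>x. \<bar>w x\<bar> \<partial>\<mu>"
  have N: "0 \<le> ?N" by simp
  have "norm (K w y *\<^sub>R Kvec (\<lambda>_. 1) y) \<le> (5 / 4 * ?N) * (5 / 4 * B)"
    unfolding norm_scaleR
    by (intro mult_mono) (use abs_K_le[OF w y] norm_Kvec_one_le[OF y] in auto)
  then have "norm (Kvec w y - K w y *\<^sub>R Kvec (\<lambda>_. 1) y) \<le> 5 / 4 * B * ?N + (5 / 4 * ?N) * (5 / 4 * B)"
    using norm_Kvec_le[OF w y] by (intro order_trans[OF norm_triangle_ineq4] add_mono)
  \<comment> \<open>The constants add up to 5/4 + 25/16 = 45/16, rounded up to 3.\<close>
  also have "\<dots> \<le> 3 * (B * ?N)"
    using mult_nonneg_nonneg[OF B_nonneg N] by (simp add: algebra_simps)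
  finally have "t * norm (Kvec w y - K w y *\<^sub>R Kvec (\<lambda>_. 1) y) \<le> t * (3 * (B * ?N))"
    using t_pos by (intro mult_left_mono) auto
  then show ?thesis using t_pos by (simp add: G_def mult_ac)
qed

section \<open>Derivatives of \<open>a\<close>, of \<open>K w\<close> and of the kernel\<close>

lemma integrable_mult_a:
  "integrable \<mu> w \<Longrightarrow> integrable \<mu> (\<lambda>x. w x * a x)"
  by (subst mult.commute) (rule integrable_continuous_mult[OF _ a_cont])

lemma integrable_a: "integrable \<mu> a"
  by (rule integrable_continuous[OF a_cont])

text \<open>The normalisation at \<open>y\<close> can be solved for \<open>a y\<close>. This
  upgrades the continuity of \<open>a\<close> to differentiability, because \<open>a\<close> becomes
  the reciprocal of a Laplace transform.\<close>

lemma a_eq_inverse: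
  assumes "y \<in> X"
  shows "a y = inverse (\<integral>x. a x * exp (t * (x \<bullet> y)) \<partial>\<mu>)"
proof -
  have "(\<integral>x. a x * exp (t * (x \<bullet> y)) \<partial>\<mu>) * a y = 1"
    unfolding integral_mult_left_zero[symmetric] kernel_normalised[OF assms, symmetric]
    by (rule Bochner_Integration.integral_cong) auto
  then show ?thesis by (simp add: inverse_unique)
qed

lemma a_has_derivative:
  assumes y: "y \<in> X"
  shows "(a has_derivative (\<lambda>h. (- (t * a y) *\<^sub>R Kvec (\<lambda>_. 1) y) \<bullet> h)) (at y within X)"
proof (rule has_derivative_transform[OF y a_eq_inverse])
  let ?A = "\<lambda>y. \<integral>x. a x * exp (t * (x \<bullet> y)) \<partial>\<mu>"
  have A: "?A y \<noteq> 0" "a y = inverse (?A y)"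
    using a_eq_inverse[OF y] a_pos[OF y] by auto
  have "Kvec (\<lambda>_. 1) y = a y *\<^sub>R (\<integral>x. (a x * exp (t * (x \<bullet> y))) *\<^sub>R x \<partial>\<mu>)"
    by (simp add: Kvec_def k_def algebra_simps flip: integral_scaleR_right)
  then show "((\<lambda>y. inverse (?A y)) has_derivative (\<lambda>h. (- (t * a y) *\<^sub>R Kvec (\<lambda>_. 1) y) \<bullet> h)) (at y within X)"
    using A by (auto intro!: derivative_eq_intros laplace_has_derivative[OF integrable_a]
        simp: algebra_simps)
qed

lemma K_eq_laplace: "K w y = a y * (\<integral>x. (w x * a x) * exp (t * (x \<bullet> y)) \<partial>\<mu>)"
  by (simp add: K_def k_def mult_ac flip: integral_mult_right_zero)

lemma Kvec_eq_laplace: "Kvec w y = a y *\<^sub>R (\<integral>x. ((w x * a x) * exp (t * (x \<bullet> y))) *\<^sub>R x \<partial>\<mu>)"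
  by (simp add: Kvec_def k_def mult_ac flip: integral_scaleR_right)

text \<open>Product rule for \<open>a\<close> times a Laplace transform: differentiating
  \<open>a\<close> yields the barycentre term of \<open>G\<close>, differentiating the transform
  yields the term with \<open>Kvec w y\<close>.\<close>

lemma K_has_derivative:
  assumes w: "integrable \<mu> w" and y: "y \<in> X"
  shows "(K w has_derivative (\<lambda>h. G w y \<bullet> h)) (at y within X)"
proof -
  have "((\<lambda>y. a y * (\<integral>x. (w x * a x) * exp (t * (x \<bullet> y)) \<partial>\<mu>)) has_derivative (\<lambda>h. G w y \<bullet> h)) (at y within X)"
    by (rule has_derivative_eq_rhs[OF has_derivative_mult[OF a_has_derivative[OF y]
          laplace_has_derivative[OF integrable_mult_a[OF w]]]])
      (simp add: fun_eq_iff G_def K_eq_laplace[of w] Kvec_eq_laplace[of w] inner_diff_left right_diff_distrib mult_ac)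
  then show ?thesis by (simp add: K_eq_laplace[abs_def])
qed

lemma K_cont: "integrable \<mu> w \<Longrightarrow> continuous_on X (K w)"
  by (rule has_derivative_continuous_on[OF K_has_derivative])

lemma G_cont:
  assumes w: "integrable \<mu> w"
  shows "continuous_on X (G w)"
proof -
  have "continuous_on X (Kvec u)" if "integrable \<mu> u" for u
    unfolding Kvec_eq_laplace[abs_def]
    by (intro continuous_intros a_cont laplace_gradient_continuous_on integrable_mult_a that)
  then show ?thesis
    unfolding G_def[abs_def] using w by (intro continuous_intros K_cont) auto
qed

lemma k_has_derivative:
  assumes x: "x \<in> X"
  shows "((\<lambda>x. k x y) has_derivative (\<lambda>h. (t * k x y) *\<^sub>R (y - Kvec (\<lambda>_. 1) x) \<bullet> h)) (at x within X)"
  unfolding k_def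
  by (auto intro!: derivative_eq_intros a_has_derivative[OF x]
      simp: algebra_simps inner_diff_left inner_commute)

section \<open>Inverting the identity minus the square of \<open>K\<close> modulo constants\<close>

lemma integral_abs_le_of_bound:
  fixes w :: "'a \<Rightarrow> real"
  assumes "integrable \<mu> w" "\<And>x. x \<in> X \<Longrightarrow> \<bar>w x\<bar> \<le> M"
  shows "(\<integral>x. \<bar>w x\<bar> \<partial>\<mu>) \<le> M"
proof -
  have "(\<integral>x. \<bar>w x\<bar> \<partial>\<mu>) \<le> (\<integral>x. M \<partial>\<mu>)"
    by (rule Bochner_Integration.integral_mono) (use assms space_mu in auto)
  then show ?thesis by (simp add: prob_space)
qed

lemma abs_K_le_of_bound:
  assumes "integrable \<mu> w" "y \<in> X" "\<And>x. x \<in> X \<Longrightarrow> \<bar>w x\<bar> \<le> M"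
  shows "\<bar>K w y\<bar> \<le> 5 / 4 * M"
  using abs_K_le[OF assms(1,2)] integral_abs_le_of_bound[OF assms(1,3)] by auto

text \<open>Both values lie within \<open>\<delta> * M \<le> M / 4\<close> of the same number, the
  integral of \<open>w\<close>.\<close>

lemma osc_K_le:
  assumes w: "integrable \<mu> w" "\<And>x. x \<in> X \<Longrightarrow> \<bar>w x\<bar> \<le> M" and y: "y \<in> X" "z \<in> X"
  shows "\<bar>K w y - K w z\<bar> \<le> M / 2"
proof -
  have "\<delta> * (\<integral>x. \<bar>w x\<bar> \<partial>\<mu>) \<le> 1 / 4 * M"
    using integral_abs_le_of_bound[OF w] \<delta>_le \<delta>_nonneg by (intro mult_mono) auto
  then show ?thesis
    using abs_K_minus_integral_le[OF w(1) y(1)] abs_K_minus_integral_le[OF w(1) y(2)] by linarith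
qed

text \<open>The inner \<open>K\<close> enlarges the supremum by at most 5/4, and the outer one has
  oscillation at most half of the result. The factor 5/8 < 1 drives both injectivity and solvability
  below.\<close>

lemma osc_KK_le:
  assumes "continuous_on X w" "\<And>x. x \<in> X \<Longrightarrow> \<bar>w x\<bar> \<le> M" "y \<in> X" "z \<in> X"
  shows "\<bar>K (K w) y - K (K w) z\<bar> \<le> 5 / 8 * M"
proof -
  have w: "integrable \<mu> w" by (rule integrable_continuous[OF assms(1)])
  have "\<bar>K (K w) y - K (K w) z\<bar> \<le> (5 / 4 * M) / 2"
    by (rule osc_K_le)
      (use w abs_K_le_of_bound[OF w _ assms(2)] K_cont[OF w] integrable_continuous assms in auto)
  then show ?thesis by simp
qed

lemma KK_diff:
  assumes "continuous_on X u" "continuous_on X w" "y \<in> X"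
  shows "K (K (\<lambda>x. u x - w x)) y = K (K u) y - K (K w) y"
proof -
  have i: "integrable \<mu> u" "integrable \<mu> w" using assms integrable_continuous by auto
  have "K (K (\<lambda>x. u x - w x)) y = K (\<lambda>x. K u x - K w x) y"
    by (rule K_cong) (rule K_diff[OF i])
  also have "\<dots> = K (K u) y - K (K w) y"
    by (rule K_diff) (use K_cont i integrable_continuous assms in auto)
  finally show ?thesis .
qed

lemma KK_const: "y \<in> X \<Longrightarrow> K (K (\<lambda>_. b)) y = b"
proof -
  have *: "K (\<lambda>_. b) x = b" if "x \<in> X" for x b
    unfolding K_def using integral_k[OF that] by simp
  show "y \<in> X \<Longrightarrow> K (K (\<lambda>_. b)) y = b"
    using K_cong[of "K (\<lambda>_. b)" "\<lambda>_. b"] * by simp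
qed

text \<open>Subtracting the value at \<open>z\<close> leaves \<open>u\<close> with
  \<open>u y = K (K u) y - K (K u) z\<close>. At a maximum point of \<open>\<bar>u\<bar>\<close> the
  oscillation bound gives \<open>\<bar>u\<bar> \<le> 5 / 8 * \<bar>u\<bar>\<close>, so
  \<open>u\<close> vanishes on \<open>X\<close>.\<close>

lemma id_minus_KK_injective:
  assumes w: "continuous_on X w"
    and c: "\<And>y. y \<in> X \<Longrightarrow> w y - K (K w) y = c"
  obtains b where "\<And>y. y \<in> X \<Longrightarrow> w y = b"
proof -
  obtain z where z: "z \<in> X" using X_nonempty by blast
  define u where "u y = w y - w z" for y
  have u: "continuous_on X u" unfolding u_def by (intro continuous_intros w)
  have eq: "u y = K (K u) y - K (K u) z" if y: "y \<in> X" for y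
    using c[OF y] c[OF z] KK_diff[OF w _ y, of "\<lambda>_. w z"] KK_diff[OF w _ z, of "\<lambda>_. w z"]
      KK_const[OF y] KK_const[OF z] by (simp add: u_def[abs_def])
  obtain x0 where x0: "x0 \<in> X" "\<And>y. y \<in> X \<Longrightarrow> \<bar>u y\<bar> \<le> \<bar>u x0\<bar>"
    using continuous_attains_sup[OF compact_X X_nonempty, of "\<lambda>y. \<bar>u y\<bar>"] u
    by (auto intro!: continuous_intros)
  have "\<bar>u x0\<bar> \<le> 5 / 8 * \<bar>u x0\<bar>"
    using eq[OF x0(1)] osc_KK_le[OF u x0(2) x0(1) z] by simp
  then have "u x0 = 0" by simp
  then have "w y = w z" if "y \<in> X" for y using x0(2)[OF that] by (simp add: u_def)
  then show ?thesis using that by blast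
qed

text \<open>Subtracting \<open>K (K \<phi>) z\<close> in the iteration fixes a representative modulo
  constants and makes the iteration a contraction in the supremum norm. The subtracted value
  reappears as the constant \<open>c\<close>.\<close>

lemma id_minus_KK_solvable:
  assumes p: "continuous_on X p" and P: "\<And>x. x \<in> X \<Longrightarrow> \<bar>p x\<bar> \<le> P"
  obtains \<phi> c where "continuous_on X \<phi>" "\<And>y. y \<in> X \<Longrightarrow> \<phi> y = p y + K (K \<phi>) y + c"
    "\<And>y. y \<in> X \<Longrightarrow> \<bar>\<phi> y\<bar> \<le> 3 * P"
proof -
  obtain z where z: "z \<in> X" using X_nonempty by blast
  define T where "T \<phi> y = p y + (K (K \<phi>) y - K (K \<phi>) z)" for \<phi> y
  have KK: "continuous_on X (K (K \<phi>))" if "continuous_on X \<phi>" for \<phi>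
    using that K_cont integrable_continuous by blast
  obtain \<phi> where \<phi>: "continuous_on X \<phi>" "\<And>y. y \<in> X \<Longrightarrow> T \<phi> y = \<phi> y"
  proof (rule contraction_on_compact_convex_fixpoint[OF compact_X convex_X X_nonempty, of "5 / 8" T])
    show "continuous_on X (T g)" if "continuous_on X g" for g
      unfolding T_def by (intro continuous_intros p KK that)
    fix g h :: "'a \<Rightarrow> real" and M :: real and x assume g: "continuous_on X g" and h: "continuous_on X h"
      and M: "\<And>z. z \<in> X \<Longrightarrow> \<bar>g z - h z\<bar> \<le> M" and x: "x \<in> X"
    have "\<bar>K (K (\<lambda>x. g x - h x)) x - K (K (\<lambda>x. g x - h x)) z\<bar> \<le> 5 / 8 * M"
      by (rule osc_KK_le) (use g h M x z in \<open>auto intro!: continuous_intros\<close>)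
    then show "\<bar>T g x - T h x\<bar> \<le> 5 / 8 * M"
      using KK_diff[OF g h x] KK_diff[OF g h z] by (simp add: T_def algebra_simps)
  qed auto
  obtain x0 where x0: "x0 \<in> X" "\<And>y. y \<in> X \<Longrightarrow> \<bar>\<phi> y\<bar> \<le> \<bar>\<phi> x0\<bar>"
    using continuous_attains_sup[OF compact_X X_nonempty, of "\<lambda>y. \<bar>\<phi> y\<bar>"] \<phi>(1)
    by (auto intro!: continuous_intros)
  have "\<bar>\<phi> x0\<bar> \<le> P + 5 / 8 * \<bar>\<phi> x0\<bar>"
    using \<phi>(2)[OF x0(1)] osc_KK_le[OF \<phi>(1) x0(2) x0(1) z] P[OF x0(1)] unfolding T_def by linarith
  \<comment> \<open>From \<open>3 / 8 * \<bar>\<phi> x0\<bar> \<le> P\<close>; the factor 8/3 is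
    rounded up to 3.\<close>
  then have "\<bar>\<phi> x0\<bar> \<le> 3 * P" using P[OF x0(1)] by linarith
  then show ?thesis
    using \<phi> x0(2) by (intro that[of \<phi> "- K (K \<phi>) z"]) (force simp: T_def)+
qed

section \<open>The right-hand side \<open>\<Psi>\<close> and its gradient\<close>

text \<open>Expanding \<open>v x \<bullet> y\<close> in coordinates separates \<open>y\<close> from
  the integration variable, so that each term is a value of \<open>K\<close> times a coordinate of
  \<open>y\<close> or 1, and the derivative formula for \<open>K\<close> applies. The compact
  integral is recovered in \<open>\<Psi>_eq_integral\<close>.\<close>

definition \<Psi> :: "('a \<Rightarrow> 'a) \<Rightarrow> 'a \<Rightarrow> real" where
  "\<Psi> v y = (\<Sum>i\<in>Basis. (y \<bullet> i) * K (\<lambda>x. v x \<bullet> i) y) - K (\<lambda>x. v x \<bullet> Kvec (\<lambda>_. 1) x) y"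

definition grad\<Psi> :: "('a \<Rightarrow> 'a) \<Rightarrow> 'a \<Rightarrow> 'a" where
  "grad\<Psi> v y = (\<Sum>i\<in>Basis. K (\<lambda>x. v x \<bullet> i) y *\<^sub>R i + (y \<bullet> i) *\<^sub>R G (\<lambda>x. v x \<bullet> i) y)
    - G (\<lambda>x. v x \<bullet> Kvec (\<lambda>_. 1) x) y"

lemma Kvec_one_cont: "continuous_on X (Kvec (\<lambda>_. 1))"
  unfolding Kvec_eq_laplace[abs_def]
  by (intro continuous_intros a_cont laplace_gradient_continuous_on integrable_mult_a integrable_const)

lemma integrable_inner_Kvec_one:
  assumes v: "integrable \<mu> v"
  shows "integrable \<mu> (\<lambda>x. v x \<bullet> Kvec (\<lambda>_. 1) x)"
proof (rule Bochner_Integration.integrable_bound[where f="\<lambda>x. (5 / 4 * B) *\<^sub>R v x"])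
  show "AE x in \<mu>. norm (v x \<bullet> Kvec (\<lambda>_. 1) x) \<le> norm ((5 / 4 * B) *\<^sub>R v x)"
  proof (rule AE_I2)
    fix x assume "x \<in> space \<mu>"
    then have "norm (v x) * norm (Kvec (\<lambda>_. 1) x) \<le> norm (v x) * (5 / 4 * B)"
      by (intro mult_left_mono norm_Kvec_one_le) (auto simp: space_mu)
    then show "norm (v x \<bullet> Kvec (\<lambda>_. 1) x) \<le> norm ((5 / 4 * B) *\<^sub>R v x)"
      using Cauchy_Schwarz_ineq2[of "v x" "Kvec (\<lambda>_. 1) x"] B_nonneg by (simp add: mult_ac)
  qed
  show "(\<lambda>x. v x \<bullet> Kvec (\<lambda>_. 1) x) \<in> borel_measurable \<mu>"
    using borel_measurable_integrable[OF v] continuous_on_imp_measurable[OF Kvec_one_cont] by measurable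
qed (use v in auto)

lemma integral_abs_inner_Kvec_one_le:
  assumes v: "integrable \<mu> v"
  shows "(\<integral>x. \<bar>v x \<bullet> Kvec (\<lambda>_. 1) x\<bar> \<partial>\<mu>) \<le> 5 / 4 * B * (\<integral>x. norm (v x) \<partial>\<mu>)"
proof -
  have "(\<integral>x. \<bar>v x \<bullet> Kvec (\<lambda>_. 1) x\<bar> \<partial>\<mu>) \<le> (\<integral>x. (5 / 4 * B) * norm (v x) \<partial>\<mu>)"
  proof (rule Bochner_Integration.integral_mono)
    fix x assume "x \<in> space \<mu>"
    then have "norm (v x) * norm (Kvec (\<lambda>_. 1) x) \<le> norm (v x) * (5 / 4 * B)"
      by (intro mult_left_mono norm_Kvec_one_le) (auto simp: space_mu)
    then show "\<bar>v x \<bullet> Kvec (\<lambda>_. 1) x\<bar> \<le> (5 / 4 * B) * norm (v x)"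
      using Cauchy_Schwarz_ineq2[of "v x" "Kvec (\<lambda>_. 1) x"] by (simp add: mult_ac)
  qed (use v integrable_inner_Kvec_one in auto)
  then show ?thesis by simp
qed

lemma integral_abs_component_le:
  assumes v: "integrable \<mu> v" and i: "i \<in> Basis"
  shows "(\<integral>x. \<bar>v x \<bullet> i\<bar> \<partial>\<mu>) \<le> (\<integral>x. norm (v x) \<partial>\<mu>)"
  by (rule Bochner_Integration.integral_mono) (use v i Basis_le_norm in auto)

lemma \<Psi>_eq_integral:
  assumes v: "integrable \<mu> v" and y: "y \<in> X"
  shows "\<Psi> v y = (\<integral>x. (v x \<bullet> (y - Kvec (\<lambda>_. 1) x)) * k x y \<partial>\<mu>)"
proof -
  have i: "integrable \<mu> (\<lambda>x. (y \<bullet> i) * ((v x \<bullet> i) * k x y))" for i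
    using integrable_mult_k[OF _ y, of "\<lambda>x. v x \<bullet> i"] v by auto
  have "(v x \<bullet> (y - Kvec (\<lambda>_. 1) x)) * k x y
      = (\<Sum>i\<in>Basis. (y \<bullet> i) * ((v x \<bullet> i) * k x y)) - (v x \<bullet> Kvec (\<lambda>_. 1) x) * k x y" for x
    unfolding inner_diff_right euclidean_inner[of "v x" y]
    by (simp add: algebra_simps sum_distrib_left sum_distrib_right)
  then have "(\<integral>x. (v x \<bullet> (y - Kvec (\<lambda>_. 1) x)) * k x y \<partial>\<mu>) =
      (\<Sum>i\<in>Basis. (\<integral>x. (y \<bullet> i) * ((v x \<bullet> i) * k x y) \<partial>\<mu>)) - (\<integral>x. (v x \<bullet> Kvec (\<lambda>_. 1) x) * k x y \<partial>\<mu>)"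
    using i integrable_mult_k[OF integrable_inner_Kvec_one[OF v] y] by (simp add: Bochner_Integration.integral_sum)
  then show ?thesis by (simp add: \<Psi>_def K_def)
qed

text \<open>This computes \<open>H_op\<close> of the functional: the gradient of \<open>k\<close> in
  its first argument is \<open>t * k x y\<close> times the displacement of \<open>y\<close> from the
  barycentre at \<open>x\<close>.\<close>

lemma neg_div_k:
  assumes v: "integrable \<mu> v" and y: "y \<in> X" and X: "interior X \<noteq> {}"
  shows "neg_div X \<mu> v (\<lambda>x. k x y) = t * \<Psi> v y"
proof -
  have "neg_div X \<mu> v (\<lambda>x. k x y) = (\<integral>x. t * ((v x \<bullet> (y - Kvec (\<lambda>_. 1) x)) * k x y) \<partial>\<mu>)"
    unfolding neg_div_def
  proof (rule Bochner_Integration.integral_cong[OF refl])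
    fix x assume "x \<in> space \<mu>"
    then have "grad X (\<lambda>x. k x y) x = (t * k x y) *\<^sub>R (y - Kvec (\<lambda>_. 1) x)"
      using grad_eqI[OF k_has_derivative convex_X X] space_mu by simp
    then show "v x \<bullet> grad X (\<lambda>x. k x y) x = t * ((v x \<bullet> (y - Kvec (\<lambda>_. 1) x)) * k x y)"
      by (simp add: mult_ac)
  qed
  then show ?thesis using \<Psi>_eq_integral[OF v y] by simp
qed

lemma \<Psi>_has_derivative:
  assumes v: "integrable \<mu> v" and y: "y \<in> X"
  shows "(\<Psi> v has_derivative (\<lambda>h. grad\<Psi> v y \<bullet> h)) (at y within X)"
proof -
  have "((\<lambda>y. (y \<bullet> i) * K (\<lambda>x. v x \<bullet> i) y) has_derivative
      (\<lambda>h. (K (\<lambda>x. v x \<bullet> i) y *\<^sub>R i + (y \<bullet> i) *\<^sub>R G (\<lambda>x. v x \<bullet> i) y) \<bullet> h)) (at y within X)" for i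
  proof -
    have "integrable \<mu> (\<lambda>x. v x \<bullet> i)" using v by simp
    from has_derivative_mult[OF has_derivative_inner_left[OF has_derivative_ident] K_has_derivative[OF this y], of i]
    show ?thesis
      by (rule has_derivative_eq_rhs) (simp add: fun_eq_iff inner_add_right inner_commute mult.commute)
  qed
  from has_derivative_diff[OF has_derivative_sum[of Basis, OF this] K_has_derivative[OF integrable_inner_Kvec_one[OF v] y]]
  show ?thesis
    unfolding \<Psi>_def[abs_def] by (rule has_derivative_eq_rhs)
      (simp add: fun_eq_iff grad\<Psi>_def inner_diff_left inner_sum_left)
qed

lemma grad\<Psi>_cont: "integrable \<mu> v \<Longrightarrow> continuous_on X (grad\<Psi> v)"
  unfolding grad\<Psi>_def[abs_def]
  by (intro continuous_intros K_cont G_cont integrable_inner_Kvec_one) auto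

lemma \<Psi>_cont: "integrable \<mu> v \<Longrightarrow> continuous_on X (\<Psi> v)"
  by (rule has_derivative_continuous_on[OF \<Psi>_has_derivative])

lemma abs_\<Psi>_le:
  assumes v: "integrable \<mu> v" and y: "y \<in> X"
  shows "\<bar>\<Psi> v y\<bar> \<le> 2 * (real DIM('a) + 1) * B * (\<integral>x. norm (v x) \<partial>\<mu>)"
proof -
  let ?N = "\<integral>x. norm (v x) \<partial>\<mu>"
  have N: "0 \<le> ?N" by simp
  have "\<bar>(y \<bullet> i) * K (\<lambda>x. v x \<bullet> i) y\<bar> \<le> B * (5 / 4 * ?N)" if i: "i \<in> Basis" for i
  proof -
    have "\<bar>K (\<lambda>x. v x \<bullet> i) y\<bar> \<le> 5 / 4 * ?N"
      using abs_K_le[OF _ y, of "\<lambda>x. v x \<bullet> i"] integral_abs_component_le[OF v i] v by auto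
    moreover have "\<bar>y \<bullet> i\<bar> \<le> B" using Basis_le_norm[OF i, of y] norm_le_B[OF y] by simp
    ultimately show ?thesis unfolding abs_mult by (intro mult_mono) auto
  qed
  then have "\<bar>\<Sum>i\<in>Basis. (y \<bullet> i) * K (\<lambda>x. v x \<bullet> i) y\<bar> \<le> DIM('a) * (B * (5 / 4 * ?N))"
    using sum_norm_bound[of Basis "\<lambda>i. (y \<bullet> i) * K (\<lambda>x. v x \<bullet> i) y" "B * (5 / 4 * ?N)"] by simp
  moreover have "\<bar>K (\<lambda>x. v x \<bullet> Kvec (\<lambda>_. 1) x) y\<bar> \<le> 5 / 4 * (5 / 4 * B * ?N)"
    using abs_K_le[OF integrable_inner_Kvec_one[OF v] y] integral_abs_inner_Kvec_one_le[OF v] by linarith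
  ultimately have "\<bar>\<Psi> v y\<bar> \<le> DIM('a) * (B * (5 / 4 * ?N)) + 5 / 4 * (5 / 4 * B * ?N)"
    unfolding \<Psi>_def by linarith
  also have "\<dots> = (5 / 4 * DIM('a) + 25 / 16) * (B * ?N)" by (simp add: algebra_simps)
  \<comment> \<open>Both 5/4 and 25/16 are rounded up to 2.\<close>
  also have "\<dots> \<le> (2 * (real DIM('a) + 1)) * (B * ?N)"
    by (rule mult_right_mono) (use mult_nonneg_nonneg[OF B_nonneg N] in auto)
  finally show ?thesis by (simp add: mult_ac)
qed

text \<open>The terms \<open>K (\<lambda>x. v x \<bullet> i) y *\<^sub>R i\<close> differ from the
  coordinates of the mean of \<open>v\<close> by at most \<open>\<delta>\<close> times the L1 norm
  of \<open>v\<close>. All other terms contain a gradient \<open>G\<close> and thus carry a factor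
  \<open>t\<close>.\<close>

lemma norm_grad\<Psi>_minus_mean_le:
  assumes v: "integrable \<mu> v" and y: "y \<in> X"
  shows "norm (grad\<Psi> v y - (\<integral>x. v x \<partial>\<mu>))
    \<le> (DIM('a) * (\<delta> + 3 * t * B\<^sup>2) + 4 * t * B\<^sup>2) * (\<integral>x. norm (v x) \<partial>\<mu>)"
proof -
  let ?N = "\<integral>x. norm (v x) \<partial>\<mu>"
  define r where "r i = (K (\<lambda>x. v x \<bullet> i) y - (\<integral>x. v x \<bullet> i \<partial>\<mu>)) *\<^sub>R i + (y \<bullet> i) *\<^sub>R G (\<lambda>x. v x \<bullet> i) y" for i
  have "(\<integral>x. v x \<partial>\<mu>) = (\<Sum>i\<in>Basis. (\<integral>x. v x \<bullet> i \<partial>\<mu>) *\<^sub>R i)"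
    using v by (simp add: euclidean_representation)
  then have eq: "grad\<Psi> v y - (\<integral>x. v x \<partial>\<mu>) = sum r Basis - G (\<lambda>x. v x \<bullet> Kvec (\<lambda>_. 1) x) y"
    by (simp add: grad\<Psi>_def r_def algebra_simps sum.distrib sum_subtractf)
  have r: "norm (r i) \<le> \<delta> * ?N + B * (3 * t * B * ?N)" if i: "i \<in> Basis" for i
  proof -
    have vi: "integrable \<mu> (\<lambda>x. v x \<bullet> i)" using v by simp
    note c = integral_abs_component_le[OF v i]
    have "\<bar>K (\<lambda>x. v x \<bullet> i) y - (\<integral>x. v x \<bullet> i \<partial>\<mu>)\<bar> \<le> \<delta> * ?N"
      using abs_K_minus_integral_le[OF vi y] mult_left_mono[OF c \<delta>_nonneg] by linarith
    then have "norm ((K (\<lambda>x. v x \<bullet> i) y - (\<integral>x. v x \<bullet> i \<partial>\<mu>)) *\<^sub>R i) \<le> \<delta> * ?N"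
      using i by simp
    moreover have "norm (G (\<lambda>x. v x \<bullet> i) y) \<le> 3 * t * B * ?N"
      by (rule order_trans[OF norm_G_le[OF vi y] mult_left_mono[OF c]]) (use t_pos B_nonneg in simp)
    moreover have "\<bar>y \<bullet> i\<bar> \<le> B" using Basis_le_norm[OF i, of y] norm_le_B[OF y] by simp
    ultimately have "norm ((y \<bullet> i) *\<^sub>R G (\<lambda>x. v x \<bullet> i) y) \<le> B * (3 * t * B * ?N)"
      "norm ((K (\<lambda>x. v x \<bullet> i) y - (\<integral>x. v x \<bullet> i \<partial>\<mu>)) *\<^sub>R i) \<le> \<delta> * ?N"
      unfolding norm_scaleR[of "y \<bullet> i"] using B_nonneg by (blast intro: mult_mono norm_ge_zero)+
    then show ?thesis unfolding r_def by (intro norm_triangle_le) linarith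
  qed
  have "norm (sum r Basis) \<le> DIM('a) * (\<delta> * ?N + B * (3 * t * B * ?N))"
    using sum_norm_bound[of Basis r, OF r] by simp
  moreover have "norm (G (\<lambda>x. v x \<bullet> Kvec (\<lambda>_. 1) x) y) \<le> 3 * t * B * (5 / 4 * B * ?N)"
    by (rule order_trans[OF norm_G_le[OF integrable_inner_Kvec_one[OF v] y] mult_left_mono[OF integral_abs_inner_Kvec_one_le[OF v]]])
      (use t_pos B_nonneg in simp)
  ultimately have "norm (grad\<Psi> v y - (\<integral>x. v x \<partial>\<mu>))
      \<le> DIM('a) * (\<delta> * ?N + B * (3 * t * B * ?N)) + 3 * t * B * (5 / 4 * B * ?N)"
    unfolding eq by (intro order_trans[OF norm_triangle_ineq4] add_mono)
  \<comment> \<open>The constant 3 * 5/4 = 15/4 is rounded up to 4.\<close>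
  also have "\<dots> \<le> DIM('a) * (\<delta> * ?N + B * (3 * t * B * ?N)) + 4 * (t * B\<^sup>2 * ?N)"
    using t_pos B_nonneg by (simp add: power2_eq_square mult_ac mult_right_mono)
  finally show ?thesis by (simp add: algebra_simps power2_eq_square)
qed

text \<open>The fixed point equation expresses the continuous solution by differentiable functions,
  so \<open>\<phi>\<close> is C1 with gradient \<open>grad\<Psi> v y + G (K \<phi>) y\<close>. The
  second summand is of order \<open>t\<close> by the supremum bound on \<open>\<phi>\<close>; the
  first is close to the mean of \<open>v\<close>.\<close>

lemma C1_solution:
  assumes v: "integrable \<mu> v"
  obtains g \<phi> c where "continuous_on X g"
    "\<And>y. y \<in> X \<Longrightarrow> (\<phi> has_derivative (\<lambda>h. g y \<bullet> h)) (at y within X)"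
    "\<And>y. y \<in> X \<Longrightarrow> \<phi> y - K (K \<phi>) y = \<Psi> v y + c"
    "\<And>y. y \<in> X \<Longrightarrow> norm (g y - (\<integral>x. v x \<partial>\<mu>))
      \<le> (DIM('a) * \<delta> + 30 * (real DIM('a) + 1) * t * B\<^sup>2) * (\<integral>x. norm (v x) \<partial>\<mu>)"
proof -
  let ?N = "\<integral>x. norm (v x) \<partial>\<mu>" and ?d = "real DIM('a)"
  define P where "P = 2 * (?d + 1) * B * ?N"
  have PP: "\<bar>\<Psi> v y\<bar> \<le> P" if "y \<in> X" for y
    using abs_\<Psi>_le[OF v that] by (simp add: P_def add.commute)
  obtain \<phi> c where \<phi>: "continuous_on X \<phi>" "\<And>y. y \<in> X \<Longrightarrow> \<phi> y = \<Psi> v y + K (K \<phi>) y + c"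
    "\<And>y. y \<in> X \<Longrightarrow> \<bar>\<phi> y\<bar> \<le> 3 * P"
    by (rule id_minus_KK_solvable[OF \<Psi>_cont[OF v] PP]) (assumption, blast intro: that)
  have i\<phi>: "integrable \<mu> \<phi>" by (rule integrable_continuous[OF \<phi>(1)])
  have iK: "integrable \<mu> (K \<phi>)" by (rule integrable_continuous[OF K_cont[OF i\<phi>]])
  define g where "g y = grad\<Psi> v y + G (K \<phi>) y" for y
  show ?thesis
  proof (rule that[of g \<phi> c])
    show "continuous_on X g" unfolding g_def
      by (intro continuous_intros grad\<Psi>_cont v G_cont iK)
    fix y assume y: "y \<in> X"
    show "(\<phi> has_derivative (\<lambda>h. g y \<bullet> h)) (at y within X)"
    proof (rule has_derivative_transform[OF y \<phi>(2)])
      show "((\<lambda>y. \<Psi> v y + K (K \<phi>) y + c) has_derivative (\<lambda>h. g y \<bullet> h)) (at y within X)"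
        by (auto intro!: derivative_eq_intros \<Psi>_has_derivative v y K_has_derivative iK
            simp: g_def inner_add_left)
    qed
    show "\<phi> y - K (K \<phi>) y = \<Psi> v y + c" using \<phi>(2)[OF y] by linarith
    have "\<bar>K \<phi> x\<bar> \<le> 5 / 4 * (3 * P)" if "x \<in> X" for x
      by (rule abs_K_le_of_bound[OF i\<phi> that \<phi>(3)])
    then have "(\<integral>x. \<bar>K \<phi> x\<bar> \<partial>\<mu>) \<le> 5 / 4 * (3 * P)" by (rule integral_abs_le_of_bound[OF iK])
    then have "norm (G (K \<phi>) y) \<le> 3 * t * B * (5 / 4 * (3 * P))"
      by (rule order_trans[OF norm_G_le[OF iK y] mult_left_mono]) (use t_pos B_nonneg in simp)
    also have "\<dots> = 45 / 2 * ((?d + 1) * (t * B\<^sup>2 * ?N))" by (simp add: P_def power2_eq_square)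
    finally have "norm (g y - (\<integral>x. v x \<partial>\<mu>)) \<le>
        (?d * (\<delta> + 3 * t * B\<^sup>2) + 4 * t * B\<^sup>2) * ?N + 45 / 2 * ((?d + 1) * (t * B\<^sup>2 * ?N))"
      using norm_grad\<Psi>_minus_mean_le[OF v y] norm_triangle_ineq[of "grad\<Psi> v y - (\<integral>x. v x \<partial>\<mu>)" "G (K \<phi>) y"]
      unfolding g_def by (simp add: algebra_simps)
    also have "\<dots> = ?d * \<delta> * ?N + (3 * ?d + 4 + 45 / 2 * (?d + 1)) * (t * B\<^sup>2 * ?N)"
      by (simp add: field_simps)
    \<comment> \<open>The coefficient is \<open>51 / 2 * ?d + 53 / 2\<close>, rounded up to
      \<open>30 * (?d + 1)\<close>.\<close>
    also have "\<dots> \<le> ?d * \<delta> * ?N + (30 * (?d + 1)) * (t * B\<^sup>2 * ?N)"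
      by (intro add_left_mono mult_right_mono) (use t_pos in auto)
    finally show "norm (g y - (\<integral>x. v x \<partial>\<mu>)) \<le> (?d * \<delta> + 30 * (?d + 1) * t * B\<^sup>2) * ?N"
      by (simp add: algebra_simps)
  qed
qed

end

subsection \<open>The self-transport potential for weak coupling\<close>

lemma sq_cost_nonneg: "0 \<le> sq_cost x y"
  by (simp add: sq_cost_def)

lemma sq_cost_expand: "sq_cost x y = (norm x)\<^sup>2 + (norm y)\<^sup>2 - 2 * (x \<bullet> y)"
  by (simp add: sq_cost_def power2_norm_eq_inner inner_diff_left inner_diff_right inner_commute)

text \<open>Here \<open>\<eta>\<close> stands for \<open>1 / \<epsilon>\<close>, and potentials are
  scaled to \<open>g = \<eta> * f\<close>. The cost on \<open>X\<close> is at most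
  \<open>4 * B\<^sup>2\<close>, so the weights \<open>exp (- (\<eta> * sq_cost x y))\<close> lie in
  \<open>[1 / r, 1]\<close> for the \<open>r\<close> below, and smallness of \<open>\<eta>\<close>
  means \<open>r\<^sup>2 \<le> 5 / 4\<close>.\<close>

locale weakly_coupled = prob_on_compact \<mu> X B
  for \<mu> :: "'a::euclidean_space measure" and X :: "'a set" and B :: real +
  fixes \<eta> :: real
  assumes \<eta>_pos: "0 < \<eta>" and \<eta>_small: "exp (8 * \<eta> * B\<^sup>2) \<le> 5 / 4"
begin

definition r :: real where "r = exp (4 * \<eta> * B\<^sup>2)"

text \<open>\<open>\<lambda>y. - ln (S g y)\<close> is the Sinkhorn update of the scaled potential
  \<open>g\<close>; its continuous fixed points on \<open>X\<close> are the solutions of the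
  normalisation equation.\<close>

definition S :: "('a \<Rightarrow> real) \<Rightarrow> 'a \<Rightarrow> real" where
  "S g y = (\<integral>x. exp (g x - \<eta> * sq_cost x y) \<partial>\<mu>)"

lemma r_ge_1: "1 \<le> r"
  using \<eta>_pos by (simp add: r_def)

lemma r_squared: "r\<^sup>2 = exp (8 * \<eta> * B\<^sup>2)" "r\<^sup>2 \<le> 5 / 4"
proof -
  show "r\<^sup>2 = exp (8 * \<eta> * B\<^sup>2)" by (simp add: r_def power2_eq_square flip: exp_add)
  then show "r\<^sup>2 \<le> 5 / 4" using \<eta>_small by simp
qed

lemma exp_cost_bounds:
  assumes "x \<in> X" "y \<in> X"
  shows "exp (- (\<eta> * sq_cost x y)) \<le> 1" "1 \<le> r * exp (- (\<eta> * sq_cost x y))"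
proof -
  show "exp (- (\<eta> * sq_cost x y)) \<le> 1" using \<eta>_pos mult_nonneg_nonneg[OF _ sq_cost_nonneg[of x y], of \<eta>] by simp
  have "norm (x - y) \<le> 2 * B"
    using norm_triangle_ineq4[of x y] norm_le_B[OF assms(1)] norm_le_B[OF assms(2)] by linarith
  then have "sq_cost x y \<le> (2 * B)\<^sup>2" unfolding sq_cost_def by (rule power_mono) simp
  then have "\<eta> * sq_cost x y \<le> \<eta> * (4 * B\<^sup>2)"
    using \<eta>_pos by (intro mult_left_mono) (auto simp: power_mult_distrib)
  then show "1 \<le> r * exp (- (\<eta> * sq_cost x y))"
    by (simp add: r_def flip: exp_add)
qed

lemma S_integrable:
  assumes "continuous_on X g"
  shows "integrable \<mu> (\<lambda>x. exp (g x - \<eta> * sq_cost x y))"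
  by (rule integrable_continuous) (auto intro!: continuous_intros assms simp: sq_cost_def)

lemma S_cont:
  assumes g: "continuous_on X g"
  shows "continuous_on X (S g)"
proof -
  \<comment> \<open>Expanding the squared distance turns \<open>S g\<close> into a Gaussian factor
    times a Laplace transform.\<close>
  have "S g y = exp (- \<eta> * (norm y)\<^sup>2) * (\<integral>x. exp (g x - \<eta> * (norm x)\<^sup>2) * exp (2 * \<eta> * (x \<bullet> y)) \<partial>\<mu>)" for y
    unfolding S_def integral_mult_right_zero[symmetric]
    by (rule Bochner_Integration.integral_cong)
      (auto simp: sq_cost_expand algebra_simps simp flip: exp_add)
  moreover have "integrable \<mu> (\<lambda>x. exp (g x - \<eta> * (norm x)\<^sup>2))"
    by (rule integrable_continuous) (intro continuous_intros g)
  ultimately show ?thesis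
    by (auto intro!: continuous_intros laplace_continuous_on)
qed

lemma S_pos:
  assumes g: "continuous_on X g" and y: "y \<in> X"
  shows "0 < S g y"
proof -
  obtain M where M: "0 < M" "\<And>x. x \<in> X \<Longrightarrow> norm (g x) \<le> M" using continuous_on_bound[OF g] by blast
  have "(\<integral>x. exp (- M) * (1 / r) \<partial>\<mu>) \<le> S g y" unfolding S_def
  proof (rule Bochner_Integration.integral_mono)
    fix x assume "x \<in> space \<mu>"
    then have x: "x \<in> X" by (simp add: space_mu)
    have "exp (- M) \<le> exp (g x)" using M(2)[OF x] by simp
    moreover have "1 / r \<le> exp (- (\<eta> * sq_cost x y))"
      using exp_cost_bounds(2)[OF x y] r_ge_1 by (simp add: field_simps)
    ultimately have "exp (- M) * (1 / r) \<le> exp (g x) * exp (- (\<eta> * sq_cost x y))"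
      using r_ge_1 by (intro mult_mono) auto
    then show "exp (- M) * (1 / r) \<le> exp (g x - \<eta> * sq_cost x y)"
      by (simp flip: exp_add)
  qed (auto intro: S_integrable g)
  moreover have "0 < exp (- M) * (1 / r)" using r_ge_1 by simp
  ultimately show ?thesis by (simp add: prob_space)
qed

section \<open>The Sinkhorn map and its contraction of oscillations\<close>

lemma S_shift: "S (\<lambda>x. g x + s) y = exp s * S g y"
  unfolding S_def integral_mult_right_zero[symmetric]
  by (rule Bochner_Integration.integral_cong) (auto simp: algebra_simps simp flip: exp_add)

lemma solution_iff_S:
  assumes g: "continuous_on X g" and y: "y \<in> X"
  shows "(\<integral>x. exp (g x + g y - \<eta> * sq_cost x y) \<partial>\<mu>) = 1 \<longleftrightarrow> - ln (S g y) = g y"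
proof -
  have "(\<integral>x. exp (g x + g y - \<eta> * sq_cost x y) \<partial>\<mu>) = exp (g y) * S g y"
    using S_shift[of g "g y" y] unfolding S_def by simp
  moreover have "exp (g y) * S g y = 1 \<longleftrightarrow> ln (exp (g y) * S g y) = 0"
    using S_pos[OF g y] by simp
  moreover have "ln (exp (g y) * S g y) = g y + ln (S g y)"
    using S_pos[OF g y] by (simp add: ln_mult)
  ultimately show ?thesis by auto
qed

text \<open>Changing \<open>y\<close> to \<open>z\<close> changes the weights of the average \<open>S g y / S h y\<close> of \<open>exp (g - h)\<close>
  by factors in \<open>[1 / r\<^sup>2, r\<^sup>2]\<close> only.\<close>

lemma ln_S_ratio_diff_le:
  assumes g: "continuous_on X g" and h: "continuous_on X h"
    and M: "\<And>x. x \<in> X \<Longrightarrow> \<bar>g x - h x\<bar> \<le> M" and y: "y \<in> X" and z: "z \<in> X"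
  shows "ln (S g y / S h y) - ln (S g z / S h z) \<le> 2 * (r\<^sup>2 - 1) * M"
proof -
  \<comment> \<open>A lower bound for \<open>exp (g x - h x)\<close> on \<open>X\<close>, hence also
    for the ratios of \<open>S g\<close> to \<open>S h\<close>.\<close>
  define m where "m = exp (- M)"
  define R where "R = S g z / S h z"
  note pos = S_pos[OF g y] S_pos[OF h y] S_pos[OF g z] S_pos[OF h z]
  have ge: "m * exp (h x) \<le> exp (g x)" if "x \<in> X" for x
    using M[OF that] by (simp add: m_def flip: exp_add)
  have w: "exp (- (\<eta> * sq_cost x u)) \<le> r * exp (- (\<eta> * sq_cost x u'))" if "x \<in> X" "u \<in> X" "u' \<in> X" for x u u'
    using exp_cost_bounds(1)[OF that(1,2)] exp_cost_bounds(2)[OF that(1,3)] by linarith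
  note int = S_integrable[OF g] S_integrable[OF h]
  \<comment> \<open>After subtraction of \<open>m * S h y\<close> the integrand is nonnegative, so
    replacing \<open>y\<close> by \<open>z\<close> in the cost loses at most a factor
    \<open>r\<close>.\<close>
  have "S g y - m * S h y = (\<integral>x. exp (g x - \<eta> * sq_cost x y) - m * exp (h x - \<eta> * sq_cost x y) \<partial>\<mu>)"
    unfolding S_def using int by simp
  also have "\<dots> \<le> (\<integral>x. r * (exp (g x - \<eta> * sq_cost x z) - m * exp (h x - \<eta> * sq_cost x z)) \<partial>\<mu>)"
  proof (rule Bochner_Integration.integral_mono)
    fix x assume "x \<in> space \<mu>"
    then have x: "x \<in> X" by (simp add: space_mu)
    have "(exp (g x) - m * exp (h x)) * exp (- (\<eta> * sq_cost x y))
        \<le> (exp (g x) - m * exp (h x)) * (r * exp (- (\<eta> * sq_cost x z)))"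
      by (rule mult_left_mono[OF w[OF x y z]]) (use ge[OF x] in simp)
    then show "exp (g x - \<eta> * sq_cost x y) - m * exp (h x - \<eta> * sq_cost x y)
        \<le> r * (exp (g x - \<eta> * sq_cost x z) - m * exp (h x - \<eta> * sq_cost x z))"
      by (simp add: exp_diff exp_minus divide_inverse algebra_simps)
  qed (use int in auto)
  also have "\<dots> = r * (S g z - m * S h z)"
    unfolding S_def using int by simp
  finally have 1: "S g y - m * S h y \<le> r * (S g z - m * S h z)" .
  have 2: "S h z \<le> r * S h y"
  proof -
    have "S h z \<le> (\<integral>x. r * exp (h x - \<eta> * sq_cost x y) \<partial>\<mu>)" unfolding S_def
    proof (rule Bochner_Integration.integral_mono)
      fix x assume "x \<in> space \<mu>"
      then have x: "x \<in> X" by (simp add: space_mu)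
      have "exp (h x) * exp (- (\<eta> * sq_cost x z)) \<le> exp (h x) * (r * exp (- (\<eta> * sq_cost x y)))"
        by (rule mult_left_mono[OF w[OF x z y]]) simp
      then show "exp (h x - \<eta> * sq_cost x z) \<le> r * exp (h x - \<eta> * sq_cost x y)"
        by (simp add: exp_diff exp_minus divide_inverse algebra_simps)
    qed (use int in auto)
    then show ?thesis by (simp add: S_def)
  qed
  have 3: "m * S h z \<le> S g z" and 4: "m * S g z \<le> S h z"
  proof -
    have "m * S h z = (\<integral>x. m * exp (h x - \<eta> * sq_cost x z) \<partial>\<mu>)" by (simp add: S_def)
    also have "\<dots> \<le> S g z" unfolding S_def
    proof (rule Bochner_Integration.integral_mono)
      fix x assume "x \<in> space \<mu>"
      then show "m * exp (h x - \<eta> * sq_cost x z) \<le> exp (g x - \<eta> * sq_cost x z)"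
        using M[of x] by (simp add: m_def space_mu flip: exp_add)
    qed (use int in auto)
    finally show "m * S h z \<le> S g z" .
    have "m * S g z = (\<integral>x. m * exp (g x - \<eta> * sq_cost x z) \<partial>\<mu>)" by (simp add: S_def)
    also have "\<dots> \<le> S h z" unfolding S_def
    proof (rule Bochner_Integration.integral_mono)
      fix x assume "x \<in> space \<mu>"
      then show "m * exp (g x - \<eta> * sq_cost x z) \<le> exp (h x - \<eta> * sq_cost x z)"
        using M[of x] by (simp add: m_def space_mu flip: exp_add)
    qed (use int in auto)
    finally show "m * S g z \<le> S h z" .
  qed
  have R: "0 < R" "m \<le> R" "m * R \<le> 1"
    using pos 3 4 by (auto simp: R_def field_simps)
  \<comment> \<open>One factor \<open>r\<close> comes from moving the numerator from
    \<open>y\<close> to \<open>z\<close>, the other from moving the denominator back.\<close>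
  have "S g y / S h y \<le> m + r\<^sup>2 * (R - m)"
  proof -
    have "0 \<le> S g z - m * S h z" using 3 by simp
    have "S g y \<le> m * S h y + r * ((R - m) * S h z)"
    proof -
      have "S g z = R * S h z" using pos by (simp add: R_def)
      then show ?thesis using 1 by (simp add: algebra_simps)
    qed
    also have "r * ((R - m) * S h z) \<le> r * ((R - m) * (r * S h y))"
      using 2 R r_ge_1 by (intro mult_left_mono) auto
    finally show ?thesis using pos by (simp add: field_simps power2_eq_square)
  qed
  \<comment> \<open>This rests on \<open>R - m \<le> 2 * M * R\<close>: since
    \<open>m * R \<le> 1\<close>, one has
    \<open>m \<ge> m * m * R = exp (- 2 * M) * R \<ge> (1 - 2 * M) * R\<close>.\<close>
  also have "\<dots> \<le> R * (1 + 2 * (r\<^sup>2 - 1) * M)"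
  proof -
    have "m * m * R \<le> m * 1" using R by (simp add: m_def mult.assoc)
    moreover have "m * m = exp (- 2 * M)" by (simp add: m_def flip: exp_add)
    moreover have "1 - 2 * M \<le> exp (- 2 * M)" using exp_ge_add_one_self[of "- 2 * M"] by simp
    ultimately have "(1 - 2 * M) * R \<le> m"
      using R(1) mult_right_mono[of "1 - 2 * M" "exp (- 2 * M)" R] by (metis less_imp_le mult.right_neutral order_trans)
    then have "(r\<^sup>2 - 1) * (R - m) \<le> (r\<^sup>2 - 1) * (2 * M * R)"
      using r_ge_1 by (intro mult_left_mono) (auto simp: algebra_simps)
    then show ?thesis by (simp add: algebra_simps)
  qed
  finally have le: "S g y / S h y / R \<le> 1 + 2 * (r\<^sup>2 - 1) * M"
    by (simp only: pos_divide_le_eq[OF R(1)] mult.commute)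
  have "ln (S g y / S h y / R) \<le> S g y / S h y / R - 1"
    by (rule ln_le_minus_one) (use pos R in auto)
  then have "ln (S g y / S h y / R) \<le> 2 * (r\<^sup>2 - 1) * M" using le by linarith
  moreover have "ln (S g y / S h y / R) = ln (S g y / S h y) - ln R"
    by (rule ln_divide_pos) (use pos R in auto)
  ultimately show ?thesis by (simp add: R_def)
qed

text \<open>The one-sided bound is used with \<open>y\<close> and \<open>z\<close> in both orders,
  and \<open>r\<^sup>2 \<le> 5 / 4\<close> gives
  \<open>2 * (r\<^sup>2 - 1) \<le> 1 / 2\<close>.\<close>

lemma osc_ln_S_le:
  assumes g: "continuous_on X g" and h: "continuous_on X h"
    and M: "\<And>x. x \<in> X \<Longrightarrow> \<bar>g x - h x\<bar> \<le> M" and y: "y \<in> X" and z: "z \<in> X"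
  shows "\<bar>(ln (S g y) - ln (S h y)) - (ln (S g z) - ln (S h z))\<bar> \<le> 1 / 2 * M"
proof -
  have "0 \<le> M" using M[OF y] by linarith
  then have "2 * (r\<^sup>2 - 1) * M \<le> 1 / 2 * M"
    using r_squared(2) by (intro mult_right_mono) auto
  note le = order_trans[OF ln_S_ratio_diff_le[OF g h M] this]
  have "ln (S g u / S h u) = ln (S g u) - ln (S h u)" if "u \<in> X" for u
    using S_pos[OF g that] S_pos[OF h that] by (simp add: ln_div)
  note ln = this[OF y] this[OF z]
  show ?thesis using le[OF _ y z, unfolded ln] le[OF _ z y, unfolded ln] by (intro abs_leI) simp_all
qed

section \<open>Existence and uniqueness of the potential\<close>

text \<open>Adding a constant to \<open>g\<close> subtracts it from \<open>- ln (S g)\<close>, so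
  the Sinkhorn map does not contract constants. Normalising it to vanish at \<open>z\<close> removes
  this direction and leaves a contraction; the constant is restored afterwards.\<close>

lemma solution_exists:
  obtains g where "continuous_on X g"
    "\<And>y. y \<in> X \<Longrightarrow> (\<integral>x. exp (g x + g y - \<eta> * sq_cost x y) \<partial>\<mu>) = 1"
proof -
  obtain z where z: "z \<in> X" using X_nonempty by blast
  define T where "T g y = ln (S g z) - ln (S g y)" for g y
  obtain g where g: "continuous_on X g" "\<And>y. y \<in> X \<Longrightarrow> T g y = g y"
  proof (rule contraction_on_compact_convex_fixpoint[OF compact_X convex_X X_nonempty, of "1 / 2" T])
    show "continuous_on X (T g)" if "continuous_on X g" for g
      unfolding T_def by (intro continuous_intros S_cont that) (use S_pos[OF that] in force)+
    fix g h :: "'a \<Rightarrow> real" and M :: real and x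
    assume "continuous_on X g" "continuous_on X h" "\<And>z. z \<in> X \<Longrightarrow> \<bar>g z - h z\<bar> \<le> M" "x \<in> X"
    from osc_ln_S_le[OF this z] show "\<bar>T g x - T h x\<bar> \<le> 1 / 2 * M"
      unfolding T_def by linarith
  qed auto
  \<comment> \<open>The fixed point satisfies \<open>- ln (S g y) = g y - ln (S g z)\<close>. A
    shift by \<open>s\<close> raises \<open>g\<close> and lowers \<open>- ln (S g)\<close> by
    \<open>s\<close>, so half of the defect is the right shift.\<close>
  define s where "s = - ln (S g z) / 2"
  have c: "continuous_on X (\<lambda>x. g x + s)" by (intro continuous_intros g)
  show ?thesis
  proof (rule that[OF c])
    fix y assume y: "y \<in> X"
    have "- ln (S (\<lambda>x. g x + s) y) = g y + s"
    proof -
      have "ln (S (\<lambda>x. g x + s) y) = s + ln (S g y)"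
        using S_pos[OF g(1) y] by (simp add: S_shift ln_mult)
      moreover have "ln (S g z) - ln (S g y) = g y" using g(2)[OF y] by (simp add: T_def)
      moreover have "ln (S g z) = - 2 * s" by (simp add: s_def)
      ultimately show ?thesis by linarith
    qed
    then show "(\<integral>x. exp (g x + s + (g y + s) - \<eta> * sq_cost x y) \<partial>\<mu>) = 1"
      using solution_iff_S[OF c y] by simp
  qed
qed

text \<open>Shifting \<open>h\<close> by \<open>s\<close> to agree with \<open>g\<close> at
  \<open>x\<close> makes \<open>u\<close> vanish there, and the oscillation bound then forces
  \<open>u = 0\<close> on \<open>X\<close>. So \<open>g\<close> and \<open>h\<close> differ by
  \<open>s\<close>, and the opposite response of \<open>- ln (S g)\<close> to constants yields
  \<open>s = 0\<close>.\<close>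

lemma solution_unique:
  assumes g: "continuous_on X g" "\<And>y. y \<in> X \<Longrightarrow> (\<integral>x. exp (g x + g y - \<eta> * sq_cost x y) \<partial>\<mu>) = 1"
    and h: "continuous_on X h" "\<And>y. y \<in> X \<Longrightarrow> (\<integral>x. exp (h x + h y - \<eta> * sq_cost x y) \<partial>\<mu>) = 1"
    and x: "x \<in> X"
  shows "g x = h x"
proof -
  define s where "s = g x - h x"
  define u where "u y = g y - h y - s" for y
  have Sg: "ln (S g y) = - g y" and Sh: "ln (S h y) = - h y" if "y \<in> X" for y
    using that solution_iff_S[OF g(1)] solution_iff_S[OF h(1)] g(2) h(2) by force+
  define h' where "h' y = h y + s" for y
  have h': "continuous_on X h'" unfolding h'_def by (intro continuous_intros h)
  have Sh': "ln (S h' y) = s - h y" if "y \<in> X" for y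
    unfolding h'_def using that Sh S_pos[OF h(1) that] by (simp add: S_shift ln_mult)
  have "continuous_on X (\<lambda>y. \<bar>u y\<bar>)" unfolding u_def by (intro continuous_intros g h)
  then obtain z where z: "z \<in> X" "\<And>y. y \<in> X \<Longrightarrow> \<bar>u y\<bar> \<le> \<bar>u z\<bar>"
    using continuous_attains_sup[OF compact_X X_nonempty] by blast
  have "\<bar>(ln (S g z) - ln (S h' z)) - (ln (S g x) - ln (S h' x))\<bar> \<le> 1 / 2 * \<bar>u z\<bar>"
    by (rule osc_ln_S_le[OF g(1) h' _ z(1) x]) (use z in \<open>simp add: u_def h'_def diff_diff_eq\<close>)
  then have "\<bar>u z\<bar> \<le> 1 / 2 * \<bar>u z\<bar>"
    unfolding Sg[OF z(1)] Sg[OF x] Sh'[OF z(1)] Sh'[OF x] u_def s_def by linarith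
  then have "\<bar>u z\<bar> = 0" by simp
  then have eq: "g y = h' y" if "y \<in> X" for y using z(2)[OF that] by (simp add: u_def h'_def)
  have "S g x = S h' x" unfolding S_def
    by (rule Bochner_Integration.integral_cong) (auto simp: space_mu eq)
  then have "s = 0" using Sg[OF x] Sh'[OF x] by (simp add: s_def)
  then show ?thesis by (simp add: s_def)
qed

text \<open>This evaluates the definite description in \<open>potential\<close> for
  \<open>\<epsilon> = 1 / \<eta>\<close>. The witness is a solution divided by \<open>\<eta>\<close>
  and restricted to \<open>X\<close>; it is unique by \<open>solution_unique\<close> on
  \<open>X\<close> and by extensionality outside.\<close>

lemma potential_spec:
  "continuous_on X (potential sq_cost X (1 / \<eta>) \<mu>)"
  "y \<in> X \<Longrightarrow> (\<integral>x. exp (\<eta> * (potential sq_cost X (1 / \<eta>) \<mu> x + potential sq_cost X (1 / \<eta>) \<mu> y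
      - sq_cost x y)) \<partial>\<mu>) = 1"
proof -
  let ?P = "\<lambda>f. f \<in> extensional X \<and> continuous_on X f \<and>
     (\<forall>y\<in>X. (\<integral>x. exp (1 / (1 / \<eta>) * (f x + f y - sq_cost x y)) \<partial>\<mu>) = 1)"
  have scale: "exp (1 / (1 / \<eta>) * (f x + f y - sq_cost x y)) = exp (\<eta> * f x + \<eta> * f y - \<eta> * sq_cost x y)"
    for f :: "'a \<Rightarrow> real" and x y by (simp add: algebra_simps)
  have scale': "exp (\<eta> * f x + \<eta> * f y - \<eta> * sq_cost x y) = exp (\<eta> * (f x + f y - sq_cost x y))"
    for f :: "'a \<Rightarrow> real" and x y by (simp add: algebra_simps)
  obtain g where g: "continuous_on X g"
    "\<And>y. y \<in> X \<Longrightarrow> (\<integral>x. exp (g x + g y - \<eta> * sq_cost x y) \<partial>\<mu>) = 1"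
    using solution_exists by blast
  define f where "f = restrict (\<lambda>x. g x / \<eta>) X"
  have "?P f"
  proof (intro conjI ballI)
    show "f \<in> extensional X" by (simp add: f_def)
    have "continuous_on X (\<lambda>x. g x / \<eta>)" using \<eta>_pos by (intro continuous_intros g) auto
    then show "continuous_on X f" unfolding f_def by (simp cong: continuous_on_cong)
    fix y assume y: "y \<in> X"
    have "(\<integral>x. exp (1 / (1 / \<eta>) * (f x + f y - sq_cost x y)) \<partial>\<mu>) = (\<integral>x. exp (g x + g y - \<eta> * sq_cost x y) \<partial>\<mu>)"
      unfolding scale by (rule Bochner_Integration.integral_cong) (use y \<eta>_pos in \<open>auto simp: f_def space_mu\<close>)
    then show "(\<integral>x. exp (1 / (1 / \<eta>) * (f x + f y - sq_cost x y)) \<partial>\<mu>) = 1" using g(2)[OF y] by simp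
  qed
  moreover have "f' = f" if "?P f'" for f'
  proof (rule extensionalityI[of _ X])
    show "f' \<in> extensional X" "f \<in> extensional X" using that \<open>?P f\<close> by blast+
    fix x assume x: "x \<in> X"
    have "\<eta> * f' x = \<eta> * f x"
      by (rule solution_unique[OF _ _ _ _ x])
        (use that \<open>?P f\<close> in \<open>auto simp: scale' intro!: continuous_intros\<close>)
    then show "f' x = f x" using \<eta>_pos by simp
  qed
  ultimately have "?P (potential sq_cost X (1 / \<eta>) \<mu>)"
    unfolding potential_def by (intro theI[of ?P])
  then show "continuous_on X (potential sq_cost X (1 / \<eta>) \<mu>)"
    "y \<in> X \<Longrightarrow> (\<integral>x. exp (\<eta> * (potential sq_cost X (1 / \<eta>) \<mu> x + potential sq_cost X (1 / \<eta>) \<mu> y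
      - sq_cost x y)) \<partial>\<mu>) = 1" by auto
qed

section \<open>Distance of the kernel from one\<close>

text \<open>With \<open>A\<close> the integral of \<open>exp (g x)\<close>, the bounds on the
  weights place \<open>exp (g y) * A\<close> in \<open>[1, r]\<close>, and integrating over
  \<open>y\<close> places \<open>A * A\<close> there too. Hence \<open>exp (g x + g y)\<close> lies
  in \<open>[1 / r, r\<^sup>2]\<close> and the kernel in
  \<open>[1 / r\<^sup>2, r\<^sup>2]\<close>.\<close>

lemma abs_kernel_minus_one_le:
  assumes g: "continuous_on X g" "\<And>y. y \<in> X \<Longrightarrow> (\<integral>x. exp (g x + g y - \<eta> * sq_cost x y) \<partial>\<mu>) = 1"
    and x: "x \<in> X" and y: "y \<in> X"
  shows "\<bar>exp (g x + g y - \<eta> * sq_cost x y) - 1\<bar> \<le> r\<^sup>2 - 1"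
proof -
  define A where "A = (\<integral>x. exp (g x) \<partial>\<mu>)"
  have ig: "integrable \<mu> (\<lambda>x. exp (g x))" by (rule integrable_continuous) (intro continuous_intros g)
  have one: "exp (g y) * S g y = 1" if "y \<in> X" for y
    using g(2)[OF that] S_shift[of g "g y" y] unfolding S_def by simp
  have up: "1 \<le> exp (g y) * A" and lo: "exp (g y) * A \<le> r" if y: "y \<in> X" for y
  proof -
    have "S g y \<le> A" unfolding S_def A_def
    proof (rule Bochner_Integration.integral_mono[OF S_integrable[OF g(1)] ig])
      show "exp (g x - \<eta> * sq_cost x y) \<le> exp (g x)" for x
        using \<eta>_pos sq_cost_nonneg[of x y] by simp
    qed
    then have "exp (g y) * S g y \<le> exp (g y) * A" by (intro mult_left_mono) auto
    then show "1 \<le> exp (g y) * A" using one[OF y] by simp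
    have "A \<le> (\<integral>x. r * exp (g x - \<eta> * sq_cost x y) \<partial>\<mu>)" unfolding A_def
    proof (rule Bochner_Integration.integral_mono[OF ig])
      fix x assume "x \<in> space \<mu>"
      then have "exp (g x) * 1 \<le> exp (g x) * (r * exp (- (\<eta> * sq_cost x y)))"
        by (intro mult_left_mono exp_cost_bounds y) (auto simp: space_mu)
      then show "exp (g x) \<le> r * exp (g x - \<eta> * sq_cost x y)"
        by (simp add: exp_diff exp_minus divide_inverse algebra_simps)
    qed (use S_integrable[OF g(1)] in auto)
    then have "A \<le> r * S g y" by (simp add: S_def)
    then have "exp (g y) * A \<le> exp (g y) * (r * S g y)" by (intro mult_left_mono) auto
    then show "exp (g y) * A \<le> r" using one[OF y] by (simp add: mult_ac)
  qed
  have A2: "1 \<le> A * A" "A * A \<le> r"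
  proof -
    have const: "(\<integral>y. 1 \<partial>\<mu>) = (1 :: real)" "(\<integral>y. r \<partial>\<mu>) = r" by (simp_all add: prob_space)
    have "A * A = (\<integral>y. exp (g y) * A \<partial>\<mu>)"
      unfolding integral_mult_left_zero A_def[symmetric] ..
    moreover have "(\<integral>y. (1 :: real) \<partial>\<mu>) \<le> (\<integral>y. exp (g y) * A \<partial>\<mu>)"
      by (rule Bochner_Integration.integral_mono) (use up ig space_mu in auto)
    moreover have "(\<integral>y. exp (g y) * A \<partial>\<mu>) \<le> (\<integral>y. r \<partial>\<mu>)"
      by (rule Bochner_Integration.integral_mono) (use lo ig space_mu in auto)
    ultimately show "1 \<le> A * A" "A * A \<le> r" using const by linarith+
  qed
  define E where "E = exp (g x) * exp (g y)"
  have E_pos: "0 < E" by (simp add: E_def)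
  have p: "(exp (g x) * A) * (exp (g y) * A) = E * (A * A)" by (simp add: E_def)
  have "(exp (g x) * A) * (exp (g y) * A) \<le> r * r"
    by (rule mult_mono) (use lo[OF x] lo[OF y] up[OF y] r_ge_1 in auto)
  moreover have "1 * 1 \<le> (exp (g x) * A) * (exp (g y) * A)"
    by (rule mult_mono) (use up[OF x] up[OF y] in auto)
  moreover have "E * 1 \<le> E * (A * A)" "E * (A * A) \<le> E * r"
    using A2 E_pos by (auto intro!: mult_left_mono)
  ultimately have E: "E \<le> r\<^sup>2" "1 \<le> E * r" using p by (auto simp: power2_eq_square)
  let ?e = "exp (- (\<eta> * sq_cost x y))"
  have k: "exp (g x + g y - \<eta> * sq_cost x y) = E * ?e" by (simp add: E_def flip: exp_add)
  have "E * ?e \<le> E * 1" using exp_cost_bounds(1)[OF x y] E_pos by (intro mult_left_mono) auto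
  then have 1: "E * ?e \<le> r\<^sup>2" using E by simp
  have "1 \<le> (E * r) * (r * ?e)"
    using mult_mono[OF E(2) exp_cost_bounds(2)[OF x y]] E_pos r_ge_1 by simp
  then have 2: "1 \<le> r\<^sup>2 * (E * ?e)" by (simp add: power2_eq_square mult_ac)
  have "1 \<le> r\<^sup>2" using r_ge_1 by simp
  \<comment> \<open>The lower bound \<open>1 / r\<^sup>2\<close> is weakened to one symmetric to the
    upper bound about 1; \<open>1 / r\<^sup>2 \<ge> 2 - r\<^sup>2\<close> amounts to
    \<open>(r\<^sup>2 - 1)\<^sup>2 \<ge> 0\<close>.\<close>
  have "2 - r\<^sup>2 \<le> E * ?e"
  proof -
    have "0 \<le> (r\<^sup>2 - 1)\<^sup>2" by simp
    then have "r\<^sup>2 * (2 - r\<^sup>2) \<le> 1" by (simp add: power2_eq_square algebra_simps)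
    then have "r\<^sup>2 * (2 - r\<^sup>2) \<le> r\<^sup>2 * (E * ?e)" using 2 by linarith
    moreover have "0 < r\<^sup>2" using \<open>1 \<le> r\<^sup>2\<close> by linarith
    ultimately show ?thesis by (rule mult_left_le_imp_le)
  qed
  then show ?thesis using 1 unfolding k by linarith
qed

end

subsection \<open>The metric tensor\<close>

lemma equiv_const_rel: "equiv (C1 X) (const_rel X)"
proof (rule equivI)
  show "const_rel X \<subseteq> C1 X \<times> C1 X" by (auto simp: const_rel_def)
  show "refl_on (C1 X) (const_rel X)" by (auto simp: refl_on_def const_rel_def intro: exI[of _ 0])
  show "sym (const_rel X)"
  proof (rule symI)
    fix \<phi> \<psi> assume "(\<phi>, \<psi>) \<in> const_rel X"
    then obtain a where "\<phi> \<in> C1 X" "\<psi> \<in> C1 X" "\<forall>x\<in>X. \<phi> x = \<psi> x + a" by (auto simp: const_rel_def)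
    then show "(\<psi>, \<phi>) \<in> const_rel X" by (auto simp: const_rel_def intro: exI[of _ "- a"])
  qed
  show "trans (const_rel X)"
  proof (rule transI)
    fix \<phi> \<psi> \<theta> assume "(\<phi>, \<psi>) \<in> const_rel X" "(\<psi>, \<theta>) \<in> const_rel X"
    then obtain a b where "\<phi> \<in> C1 X" "\<theta> \<in> C1 X" "\<forall>x\<in>X. \<phi> x = \<psi> x + a" "\<forall>x\<in>X. \<psi> x = \<theta> x + b"
      unfolding const_rel_def by blast
    then show "(\<phi>, \<theta>) \<in> const_rel X" by (auto simp: const_rel_def intro: exI[of _ "b + a"])
  qed
qed

lemma const_relI:
  "\<phi> \<in> C1 X \<Longrightarrow> \<psi> \<in> C1 X \<Longrightarrow> (\<And>x. x \<in> X \<Longrightarrow> \<phi> x = \<psi> x + a) \<Longrightarrow> (\<phi>, \<psi>) \<in> const_rel X"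
  by (auto simp: const_rel_def)

lemma quot_class_eq_iff:
  "\<phi> \<in> C1 X \<Longrightarrow> \<psi> \<in> C1 X \<Longrightarrow> quot_class X \<phi> = quot_class X \<psi> \<longleftrightarrow> (\<phi>, \<psi>) \<in> const_rel X"
  unfolding quot_class_def by (rule eq_equiv_class_iff[OF equiv_const_rel])

lemma C1I:
  "continuous_on X D \<Longrightarrow> (\<And>x. x \<in> X \<Longrightarrow> (\<phi> has_derivative (\<lambda>h. D x \<bullet> h)) (at x within X)) \<Longrightarrow> \<phi> \<in> C1 X"
  unfolding C1_def by blast

lemma C1_imp_continuous_on: "\<phi> \<in> C1 X \<Longrightarrow> continuous_on X \<phi>"
  unfolding C1_def by (auto intro: has_derivative_continuous_on)

lemma C1_diff:
  assumes "\<phi> \<in> C1 X" "\<psi> \<in> C1 X"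
  shows "(\<lambda>x. \<phi> x - \<psi> x) \<in> C1 X"
proof -
  obtain D E where "continuous_on X D" "continuous_on X E"
    "\<And>x. x \<in> X \<Longrightarrow> (\<phi> has_derivative (\<lambda>h. D x \<bullet> h)) (at x within X)"
    "\<And>x. x \<in> X \<Longrightarrow> (\<psi> has_derivative (\<lambda>h. E x \<bullet> h)) (at x within X)"
    using assms unfolding C1_def by blast
  then show ?thesis
    by (intro C1I[of X "\<lambda>x. D x - E x"])
      (auto intro!: continuous_intros derivative_eq_intros simp: inner_diff_left)
qed

lemma C1_scaled:
  assumes g: "continuous_on X g"
    and \<phi>: "\<And>x. x \<in> X \<Longrightarrow> (\<phi> has_derivative (\<lambda>h. g x \<bullet> h)) (at x within X)"
    and eq: "\<And>x. x \<in> X \<Longrightarrow> \<psi> x = t * \<phi> x"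
  shows "\<psi> \<in> C1 X"
proof (rule C1I)
  show "continuous_on X (\<lambda>x. t *\<^sub>R g x)" by (intro continuous_intros g)
  fix x assume x: "x \<in> X"
  show "(\<psi> has_derivative (\<lambda>h. (t *\<^sub>R g x) \<bullet> h)) (at x within X)"
    by (rule has_derivative_transform[OF x eq])
      (auto intro!: derivative_eq_intros \<phi>[OF x])
qed

text \<open>All representatives of the class have the gradient \<open>g\<close> on \<open>X\<close>,
  so the functional maps the nonempty class to a singleton and \<open>the_elem\<close> returns its
  value.\<close>

lemma quot_pairing_neg_div:
  assumes "convex X" "interior X \<noteq> {}" and space: "space \<mu> = X"
    and g: "continuous_on X g"
    and \<phi>: "\<And>x. x \<in> X \<Longrightarrow> (\<phi> has_derivative (\<lambda>h. g x \<bullet> h)) (at x within X)"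
  shows "quot_pairing (neg_div X \<mu> v) (quot_class X \<phi>) = (\<integral>x. v x \<bullet> g x \<partial>\<mu>)"
proof -
  have "neg_div X \<mu> v \<psi> = (\<integral>x. v x \<bullet> g x \<partial>\<mu>)" if \<psi>: "\<psi> \<in> quot_class X \<phi>" for \<psi>
    unfolding neg_div_def
  proof (rule Bochner_Integration.integral_cong[OF refl])
    fix x assume "x \<in> space \<mu>"
    then have x: "x \<in> X" using space by simp
    obtain a where a: "\<forall>x\<in>X. \<phi> x = \<psi> x + a"
      using \<psi> by (auto simp: quot_class_def const_rel_def)
    have "(\<psi> has_derivative (\<lambda>h. g x \<bullet> h)) (at x within X)"
    proof (rule has_derivative_transform[OF x])
      show "\<psi> y = \<phi> y - a" if "y \<in> X" for y using a that by simp
      show "((\<lambda>y. \<phi> y - a) has_derivative (\<lambda>h. g x \<bullet> h)) (at x within X)"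
        by (auto intro!: derivative_eq_intros \<phi>[OF x])
    qed
    from grad_eqI[OF this assms(1,2) x] show "v x \<bullet> grad X \<psi> x = v x \<bullet> g x" by simp
  qed
  then have "neg_div X \<mu> v ` quot_class X \<phi> = (\<lambda>_. \<integral>x. v x \<bullet> g x \<partial>\<mu>) ` quot_class X \<phi>"
    by (rule image_cong[OF refl])
  moreover have "\<phi> \<in> quot_class X \<phi>"
    using equiv_class_self[OF equiv_const_rel C1I[OF g \<phi>]] unfolding quot_class_def by blast
  then have "(\<lambda>_. \<integral>x. v x \<bullet> g x \<partial>\<mu>) ` quot_class X \<phi> = {\<integral>x. v x \<bullet> g x \<partial>\<mu>}"
    by (rule image_constant)
  ultimately show ?thesis by (simp add: quot_pairing_def)
qed

section \<open>Evaluation of the metric tensor with an explicit error\<close>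

context near_one_kernel
begin

lemma K_in_C1: "integrable \<mu> w \<Longrightarrow> K w \<in> C1 X"
  by (rule C1I[OF G_cont K_has_derivative])

lemma id_minus_KK_in_C1:
  assumes "\<phi> \<in> C1 X"
  shows "(\<lambda>y. \<phi> y - K (K \<phi>) y) \<in> C1 X"
proof -
  have "integrable \<mu> \<phi>" using assms C1_imp_continuous_on integrable_continuous by blast
  then show ?thesis
    by (rule C1_diff[OF assms K_in_C1[OF integrable_continuous[OF K_cont]]])
qed

text \<open>Constants are fixed by \<open>K\<close> and cancel. This makes the union in
  \<open>quot_map\<close> a single class.\<close>

lemma id_minus_KK_respects_const_rel:
  assumes "(\<phi>, \<psi>) \<in> const_rel X"
  shows "((\<lambda>y. \<phi> y - K (K \<phi>) y), (\<lambda>y. \<psi> y - K (K \<psi>) y)) \<in> const_rel X"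
proof -
  obtain a where a: "\<phi> \<in> C1 X" "\<psi> \<in> C1 X" "\<And>x. x \<in> X \<Longrightarrow> \<phi> x = \<psi> x + a"
    using assms by (auto simp: const_rel_def)
  have "K (K \<phi>) y = K (K \<psi>) y + a" if y: "y \<in> X" for y
  proof -
    have "K (K \<phi>) y - K (K \<psi>) y = K (K (\<lambda>x. \<phi> x - \<psi> x)) y"
      by (rule KK_diff[OF C1_imp_continuous_on[OF a(1)] C1_imp_continuous_on[OF a(2)] y, symmetric])
    also have "\<dots> = K (K (\<lambda>_. a)) y"
      by (intro K_cong) (simp add: a)
    finally show ?thesis using KK_const[OF y] by simp
  qed
  then show ?thesis
    by (intro const_relI[where a=0] id_minus_KK_in_C1 a(1,2)) (simp add: a(3))
qed

lemma id_minus_KK_inj_mod_const: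
  assumes \<phi>: "\<phi> \<in> C1 X" and \<psi>: "\<psi> \<in> C1 X"
    and "((\<lambda>y. \<phi> y - K (K \<phi>) y), (\<lambda>y. \<psi> y - K (K \<psi>) y)) \<in> const_rel X"
  shows "(\<phi>, \<psi>) \<in> const_rel X"
proof -
  obtain a where a: "\<And>y. y \<in> X \<Longrightarrow> \<phi> y - K (K \<phi>) y = \<psi> y - K (K \<psi>) y + a"
    using assms(3) by (auto simp: const_rel_def)
  note c = \<phi>[THEN C1_imp_continuous_on] \<psi>[THEN C1_imp_continuous_on]
  obtain b where "\<And>y. y \<in> X \<Longrightarrow> \<phi> y - \<psi> y = b"
  proof (rule id_minus_KK_injective[of "\<lambda>y. \<phi> y - \<psi> y" a])
    show "continuous_on X (\<lambda>y. \<phi> y - \<psi> y)" by (intro continuous_intros c)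
    show "\<phi> y - \<psi> y - K (K (\<lambda>y. \<phi> y - \<psi> y)) y = a" if "y \<in> X" for y
      using a[OF that] KK_diff[OF c that] by simp
  qed blast
  then show ?thesis by (intro const_relI[where a=b] assms) (auto simp: algebra_simps)
qed

text \<open>Since \<open>H\<close> equals \<open>t * \<Psi> v\<close> on \<open>X\<close>, its
  preimage is the class of \<open>t * \<phi>\<close> with \<open>\<phi>\<close> from
  \<open>C1_solution\<close>. The prefactor \<open>\<epsilon> / 2 = 1 / t\<close> cancels
  \<open>t\<close>, and what remains is the integral of \<open>v x \<bullet> g x\<close> with
  \<open>g\<close> uniformly close to the mean of \<open>v\<close>.\<close>

lemma metric_tensor_approx:
  assumes v: "integrable \<mu> v" and X: "interior X \<noteq> {}" and \<epsilon>: "t = 2 / \<epsilon>"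
    and kern: "\<And>x y. kern c X \<epsilon> \<mu> x y = k x y"
  shows "\<bar>metric_tensor c X \<epsilon> \<mu> (neg_div X \<mu> v) (neg_div X \<mu> v) - (norm (\<integral>x. v x \<partial>\<mu>))\<^sup>2\<bar>
    \<le> (DIM('a) * \<delta> + 30 * (real DIM('a) + 1) * t * B\<^sup>2) * (\<integral>x. norm (v x) \<partial>\<mu>)\<^sup>2"
proof -
  let ?L = "\<lambda>\<phi> y. \<phi> y - K (K \<phi>) y" and ?A = "id_minus_K2 c X \<epsilon> \<mu>"
  let ?H = "H_op c X \<epsilon> \<mu> (neg_div X \<mu> v)" and ?V = "\<integral>x. v x \<partial>\<mu>"
  define E where "E = (DIM('a) * \<delta> + 30 * (real DIM('a) + 1) * t * B\<^sup>2) * (\<integral>x. norm (v x) \<partial>\<mu>)"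
  have K_op: "K_op c X \<epsilon> \<mu> = K" by (simp add: fun_eq_iff K_op_def K_def kern)
  have A: "?A (quot_class X \<phi>) = quot_class X (?L \<phi>)" if "\<phi> \<in> C1 X" for \<phi>
    unfolding id_minus_K2_def quot_map_def K_op quot_class_def[of X \<phi>]
  proof (rule UN_equiv_class[OF equiv_const_rel _ that])
    show "(\<lambda>\<phi>. quot_class X (?L \<phi>)) respects const_rel X"
    proof (rule congruentI)
      fix \<phi> \<psi> assume "(\<phi>, \<psi>) \<in> const_rel X"
      from id_minus_KK_respects_const_rel[OF this] show "quot_class X (?L \<phi>) = quot_class X (?L \<psi>)"
        unfolding quot_class_def by (rule equiv_class_eq[OF equiv_const_rel])
    qed
  qed
  have cls: "\<exists>\<phi>\<in>C1 X. Q = quot_class X \<phi>" if "Q \<in> C1_mod_const X" for Q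
    using that by (auto simp: C1_mod_const_def quot_class_def quotient_def)
  have inj: "inj_on ?A (C1_mod_const X)"
  proof (rule inj_onI)
    fix P Q assume "P \<in> C1_mod_const X" "Q \<in> C1_mod_const X" and eq: "?A P = ?A Q"
    then obtain \<phi> \<psi> where \<phi>: "\<phi> \<in> C1 X" "P = quot_class X \<phi>" and \<psi>: "\<psi> \<in> C1 X" "Q = quot_class X \<psi>"
      using cls by meson
    have "(?L \<phi>, ?L \<psi>) \<in> const_rel X"
      using eq A \<phi> \<psi> quot_class_eq_iff[OF id_minus_KK_in_C1 id_minus_KK_in_C1] by simp
    from id_minus_KK_inj_mod_const[OF \<phi>(1) \<psi>(1) this] show "P = Q" unfolding \<phi>(2) \<psi>(2) using quot_class_eq_iff[OF \<phi>(1) \<psi>(1)] by blast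
  qed
  obtain \<phi> g c' where g: "continuous_on X g"
    and \<phi>: "\<And>y. y \<in> X \<Longrightarrow> (\<phi> has_derivative (\<lambda>h. g y \<bullet> h)) (at y within X)"
      "\<And>y. y \<in> X \<Longrightarrow> \<phi> y - K (K \<phi>) y = \<Psi> v y + c'"
    and gV: "\<And>y. y \<in> X \<Longrightarrow> norm (g y - ?V) \<le> E"
    by (fact C1_solution[OF v, folded E_def])
  let ?u = "\<lambda>y. t * \<phi> y"
  have u: "?u \<in> C1 X" by (rule C1_scaled[OF g \<phi>(1)]) auto
  have H: "?H y = t * \<Psi> v y" if "y \<in> X" for y
    unfolding H_op_def kern using neg_div_k[OF v that X] .
  have H_C1: "?H \<in> C1 X"
    by (rule C1_scaled[OF grad\<Psi>_cont[OF v] \<Psi>_has_derivative[OF v] H])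
  have Ku: "K (K ?u) y = t * K (K \<phi>) y" for y
    by (simp add: K_def mult.assoc)
  have "(?L ?u, ?H) \<in> const_rel X"
  proof (rule const_relI[OF id_minus_KK_in_C1[OF u] H_C1, where a="t * c'"])
    fix y assume y: "y \<in> X"
    have "?L ?u y = t * (\<phi> y - K (K \<phi>) y)" unfolding Ku by (simp add: algebra_simps)
    then show "?L ?u y = ?H y + t * c'" using \<phi>(2)[OF y] H[OF y] by (simp add: algebra_simps)
  qed
  then have "?A (quot_class X ?u) = quot_class X ?H"
    using A[OF u] quot_class_eq_iff[OF id_minus_KK_in_C1[OF u] H_C1] by simp
  moreover have "quot_class X ?u \<in> C1_mod_const X"
    using u by (simp add: C1_mod_const_def quot_class_def quotientI)
  \<comment> \<open>The inverse is evaluated through injectivity and this explicit preimage.\<close>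
  ultimately have inv: "the_inv_into (C1_mod_const X) ?A (quot_class X ?H) = quot_class X ?u"
    by (rule the_inv_into_f_eq[OF inj])
  have "quot_pairing (neg_div X \<mu> v) (quot_class X ?u) = (\<integral>x. v x \<bullet> (t *\<^sub>R g x) \<partial>\<mu>)"
    by (rule quot_pairing_neg_div[OF convex_X X space_mu])
      (auto intro!: continuous_intros g derivative_eq_intros \<phi>(1))
  then have metric: "metric_tensor c X \<epsilon> \<mu> (neg_div X \<mu> v) (neg_div X \<mu> v) = (\<integral>x. v x \<bullet> g x \<partial>\<mu>)"
    unfolding metric_tensor_def inv using \<epsilon> t_pos by simp
  have ivg: "integrable \<mu> (\<lambda>x. v x \<bullet> g x)"
  proof -
    obtain M where M: "0 < M" "\<And>x. x \<in> X \<Longrightarrow> norm (g x) \<le> M" using continuous_on_bound[OF g] by blast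
    show ?thesis
    proof (rule Bochner_Integration.integrable_bound[where f="\<lambda>x. M *\<^sub>R v x"])
      show "AE x in \<mu>. norm (v x \<bullet> g x) \<le> norm (M *\<^sub>R v x)"
      proof (rule AE_I2)
        fix x assume "x \<in> space \<mu>"
        then have "norm (v x) * norm (g x) \<le> norm (v x) * M"
          using M(2) space_mu by (intro mult_left_mono) auto
        then show "norm (v x \<bullet> g x) \<le> norm (M *\<^sub>R v x)"
          using Cauchy_Schwarz_ineq2[of "v x" "g x"] M(1) by (simp add: mult.commute)
      qed
      show "(\<lambda>x. v x \<bullet> g x) \<in> borel_measurable \<mu>"
        using borel_measurable_integrable[OF v] continuous_on_imp_measurable[OF g] by measurable
    qed (use v in auto)
  qed
  \<comment> \<open>Written as an integral against \<open>v\<close>, the limit can be compared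
    pointwise through \<open>norm (g x - ?V) * norm (v x)\<close>; this produces the second factor
    of the L1 norm of \<open>v\<close>.\<close>
  have "(norm ?V)\<^sup>2 = (\<integral>x. v x \<bullet> ?V \<partial>\<mu>)"
    using v by (simp add: power2_norm_eq_inner)
  then have "\<bar>(\<integral>x. v x \<bullet> g x \<partial>\<mu>) - (norm ?V)\<^sup>2\<bar> = norm ((\<integral>x. v x \<bullet> g x \<partial>\<mu>) - (\<integral>x. v x \<bullet> ?V \<partial>\<mu>))"
    by simp
  also have "\<dots> \<le> (\<integral>x. E * norm (v x) \<partial>\<mu>)"
  proof (rule norm_integral_diff_le[OF ivg])
    fix x assume "x \<in> X"
    then have "norm (v x) * norm (g x - ?V) \<le> norm (v x) * E"
      by (intro mult_left_mono gV) auto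
    then show "norm (v x \<bullet> g x - v x \<bullet> ?V) \<le> E * norm (v x)"
      using Cauchy_Schwarz_ineq2[of "v x" "g x - ?V"] by (simp add: inner_diff_right mult.commute)
  qed (use v in auto)
  also have "\<dots> = E * (\<integral>x. norm (v x) \<partial>\<mu>)" by simp
  finally show ?thesis unfolding metric E_def by (simp add: power2_eq_square mult.assoc)
qed

end

section \<open>Passage to the limit\<close>

theorem theorem4p17:
  fixes X :: "'a::euclidean_space set"
    and \<mu> :: "'a measure"
    and v :: "'a \<Rightarrow> 'a"
    and \<mu>' :: "('a \<Rightarrow> real) \<Rightarrow> real"
  assumes "compact X" and "convex X" and "interior X \<noteq> {}"
    and "\<mu> \<in> prob_measures_on X"
    and "integrable \<mu> v"
    and "\<mu>' = neg_div X \<mu> v"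
  shows "((\<lambda>\<epsilon>. metric_tensor sq_cost X \<epsilon> \<mu> \<mu>' \<mu>') \<longlongrightarrow> (norm (\<integral>x. v x \<partial>\<mu>))\<^sup>2) at_top"
proof -
  let ?d = "real DIM('a)" and ?N = "\<integral>x. norm (v x) \<partial>\<mu>"
  obtain B where B: "\<And>x. x \<in> X \<Longrightarrow> norm x \<le> B"
    using compact_imp_bounded[OF assms(1)] unfolding bounded_iff by blast
  interpret prob_space \<mu> using assms(4) by (simp add: prob_measures_on_def)
  interpret prob_on_compact \<mu> X B
    by unfold_locales (use assms B in \<open>auto simp: prob_measures_on_def\<close>)
  \<comment> \<open>The error bound for \<open>\<eta> = 1 / \<epsilon>\<close>, with
    \<open>\<delta> = r\<^sup>2 - 1 = exp (8 * \<eta> * B\<^sup>2) - 1\<close> and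
    \<open>t = 2 * \<eta>\<close>.\<close>
  define E where "E \<epsilon> = (?d * (exp (8 * (1 / \<epsilon>) * B\<^sup>2) - 1) + 30 * (?d + 1) * (2 / \<epsilon>) * B\<^sup>2) * ?N\<^sup>2" for \<epsilon>
  have inv0: "((\<lambda>\<epsilon>::real. 1 / \<epsilon>) \<longlongrightarrow> 0) at_top"
    using tendsto_inverse_0_at_top[OF filterlim_ident] by (simp add: inverse_eq_divide)
  have exp1: "((\<lambda>\<epsilon>. exp (8 * (1 / \<epsilon>) * B\<^sup>2)) \<longlongrightarrow> exp (8 * 0 * B\<^sup>2)) at_top"
    by (intro tendsto_intros inv0)
  have "((\<lambda>\<epsilon>. (?d * (exp (8 * (1 / \<epsilon>) * B\<^sup>2) - 1) + 30 * (?d + 1) * (2 * (1 / \<epsilon>)) * B\<^sup>2) * ?N\<^sup>2)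
      \<longlongrightarrow> (?d * (exp (8 * 0 * B\<^sup>2) - 1) + 30 * (?d + 1) * (2 * 0) * B\<^sup>2) * ?N\<^sup>2) at_top"
    by (intro tendsto_intros inv0)
  then have E: "(E \<longlongrightarrow> 0) at_top" unfolding E_def[abs_def] by simp
  \<comment> \<open>For large \<open>\<epsilon>\<close> this supplies the smallness required by
    \<open>weakly_coupled\<close> and, through \<open>r\<^sup>2 \<le> 5 / 4\<close>, the bound on
    \<open>\<delta>\<close> in \<open>near_one_kernel\<close>.\<close>
  have small: "eventually (\<lambda>\<epsilon>. exp (8 * (1 / \<epsilon>) * B\<^sup>2) < 5 / 4) at_top"
    by (rule order_tendstoD(2)[OF exp1]) simp
  have "eventually (\<lambda>\<epsilon>. norm (metric_tensor sq_cost X \<epsilon> \<mu> \<mu>' \<mu>' - (norm (\<integral>x. v x \<partial>\<mu>))\<^sup>2) \<le> E \<epsilon>) at_top"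
    using small eventually_gt_at_top[of "0::real"]
  proof eventually_elim
    case (elim \<epsilon>)
    define \<eta> where "\<eta> = 1 / \<epsilon>"
    interpret weakly_coupled \<mu> X B \<eta>
      by unfold_locales (use elim in \<open>simp_all add: \<eta>_def\<close>)
    define f where "f = potential sq_cost X (1 / \<eta>) \<mu>"
    note f = potential_spec[folded f_def]
    \<comment> \<open>The parts of the cost depending on one point are absorbed into
      \<open>a\<close>; the cross term \<open>2 * \<eta> * (x \<bullet> y)\<close> remains, whence
      \<open>t = 2 * \<eta>\<close>.\<close>
    define a where "a x = exp (\<eta> * f x - \<eta> * (norm x)\<^sup>2)" for x
    have k: "a x * a y * exp (2 * \<eta> * (x \<bullet> y)) = exp (\<eta> * (f x + f y - sq_cost x y))" for x y
      unfolding a_def sq_cost_expand by (simp add: algebra_simps flip: exp_add)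
    have k': "exp (\<eta> * (f x + f y - sq_cost x y)) = exp (\<eta> * f x + \<eta> * f y - \<eta> * sq_cost x y)" for x y
      by (simp add: algebra_simps)
    interpret near_one_kernel \<mu> X B "2 * \<eta>" "r\<^sup>2 - 1" a
    proof
      show "0 < 2 * \<eta>" using \<eta>_pos by simp
      show "continuous_on X a" unfolding a_def by (intro continuous_intros f)
      show "0 < a x" for x by (simp add: a_def)
      show "(\<integral>x. a x * a y * exp (2 * \<eta> * (x \<bullet> y)) \<partial>\<mu>) = 1" if "y \<in> X" for y
        unfolding k by (rule f(2)[OF that])
      show "\<bar>a x * a y * exp (2 * \<eta> * (x \<bullet> y)) - 1\<bar> \<le> r\<^sup>2 - 1" if "x \<in> X" "y \<in> X" for x y
        unfolding k k' by (rule abs_kernel_minus_one_le[OF _ _ that])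
          (use f in \<open>auto simp flip: k' intro!: continuous_intros\<close>)
      show "r\<^sup>2 - 1 \<le> 1 / 4" using r_squared(2) by simp
    qed
    have "kern sq_cost X \<epsilon> \<mu> x y = local.k x y" for x y
      unfolding kern_def k_def k by (simp add: f_def \<eta>_def)
    from metric_tensor_approx[OF assms(5,3) _ this]
    have bound: "\<bar>metric_tensor sq_cost X \<epsilon> \<mu> (neg_div X \<mu> v) (neg_div X \<mu> v) - (norm (\<integral>x. v x \<partial>\<mu>))\<^sup>2\<bar>
        \<le> (?d * (r\<^sup>2 - 1) + 30 * (?d + 1) * (2 * \<eta>) * B\<^sup>2) * ?N\<^sup>2"
      by (simp add: \<eta>_def)
    have \<eta>: "1 / \<epsilon> = \<eta>" "2 / \<epsilon> = 2 * \<eta>" by (simp_all add: \<eta>_def)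
    show ?case using bound unfolding assms(6) E_def \<eta> r_squared(1)[symmetric] real_norm_def .
  qed
  then show ?thesis
    by (rule LIM_zero_cancel[OF Lim_null_comparison[OF _ E]])
qed

end
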